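(* Let $(M,[g])$ be a connected conformal manifold (Riemannian or pseudo-Riemannian signature) of dimension $n\ge3$. If $(M,[g])$ is weakly generic and admits a non-zero parallel standard tractor field $\mathbb{I}^A$, then it is conformally Einstein and $X_A\mathbb{I}^A$ is an Einstein scale, i.e. $\sigma:=X_A\mathbb{I}^A$ is a nowhere vanishing section of $\mathcal{E}[1]$ and $\sigma^{-2}\boldsymbol{g}$ is an Einstein metric.
   Context: All objects are smooth; abstract index notation is used. Curvature. For a metric $g$ with Levi-Civita connection $\nabla$, $(\nabla_a\nabla_b-\nabla_b\nabla_a)V^c=R_{ab}{}^c{}_dV^d$. The totally trace-free Weyl tensor $C_{abcd}$ and symmetric Schouten tensor $P_{ab}$ are defined by $R_{abcd}=C_{abcd}+2g_{c[a}P_{b]d}+2g_{d[b}P_{a]c}$; $J:=P^a{}_a$; $\Delta:=\nabla^a\nabla_a$. The metric is Einstein if $P_{ab}-\frac1n Jg_{ab}=0$, and a conformal class is conformally Einstein if it contains an Einstein metric. Genericity. A conformal structure is weakly generic if, at each $x\in M$, the only $V^d_x\in T_xM$ with $C_{abcd}V^d_x=0$ is $V^d_x=0$. Densities. $[g]$ is a class of metrics modulo multiplication by positive smooth functions. $\mathcal{E}[w]$ is the line bundle whose sections correspond to functions $f(x,g)$ of a point and a metric in the class with $f(x,\Omega^2g)=\Omega^wf(x,g)$. $\boldsymbol{g}_{ab}$, a section of $\mathcal{E}_{(ab)}[2]$, is the tautological conformal metric; a nowhere vanishing $\sigma\in\mathcal{E}[1]$ determines the metric $\sigma^{-2}\boldsymbol{g}$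 in the class. Indices are raised and lowered with $\boldsymbol{g}$. A choice of $g\in[g]$ trivialises the density bundles, and $\nabla$ acts on densities through this trivialisation. Tractors. The standard tractor bundle $\mathcal{E}^A$ is the quotient of the 2-jet bundle $J^2\mathcal{E}[1]$ by the image of the trace-free symmetric part $\mathcal{E}_{(ab)_0}[1]$ in $J^2\mathcal{E}[1]$. A choice of $g\in[g]$ splits $\mathcal{E}^A$ as $\mathcal{E}[1]\oplus\mathcal{E}_a[1]\oplus\mathcal{E}[-1]$, the class of the 2-jet of $\sigma\in\mathcal{E}[1]$ being sent to $(\sigma,\nabla_a\sigma,-\frac1n(\Delta+J)\sigma)$. The canonical projection $X_A:\mathcal{E}^A\to\mathcal{E}[1]$ is $(\sigma,\mu_a,\rho)\mapsto\sigma$. The (conformally invariant) tractor connection is $$\nabla_a(\sigma,\mu_b,\rho)=(\nabla_a\sigma-\mu_a,\ \nabla_a\mu_b+\boldsymbol{g}_{ab}\rho+P_{ab}\sigma,\ \nabla_a\rho-P_{ab}\mu^b),$$ and a standard tractor field is parallel if it is annihilated by this connection. *)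

theory Defs
  imports "HOL-Analysis.Analysis"
begin

section \<open>Smooth manifolds\<close>

definition partial :: "'n::finite \<Rightarrow> (real^'n \<Rightarrow> real) \<Rightarrow> real^'n \<Rightarrow> real" where
  "partial a f p = frechet_derivative f (at p) (axis a 1)"

text \<open>For open \<open>S\<close> this is the class of infinitely differentiable functions: all iterated partial
  derivatives exist and are differentiable, hence continuous.\<close>

definition smooth_on :: "(real^'n) set \<Rightarrow> (real^'n \<Rightarrow> real) \<Rightarrow> bool" where
  "smooth_on S f \<longleftrightarrow> (\<forall>as. \<forall>p\<in>S. foldr partial as f differentiable (at p))"

text \<open>A chart is a pair of its domain and its coordinate map; the map is irrelevant off the domain.\<close>

type_synonym ('a, 'n) chart = "'a set \<times> ('a \<Rightarrow> real^'n)"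

definition smooth_atlas :: "'a topology \<Rightarrow> ('a, 'n::finite) chart set \<Rightarrow> bool" where
  "smooth_atlas X A \<longleftrightarrow>
     (\<Union>\<kappa>\<in>A. fst \<kappa>) = topspace X \<and>
     (\<forall>\<kappa>\<in>A. openin X (fst \<kappa>) \<and> open (snd \<kappa> ` fst \<kappa>) \<and>
        homeomorphic_map (subtopology X (fst \<kappa>)) (top_of_set (snd \<kappa> ` fst \<kappa>)) (snd \<kappa>)) \<and>
     (\<forall>\<kappa>\<in>A. \<forall>\<kappa>'\<in>A. \<forall>a. smooth_on (snd \<kappa> ` (fst \<kappa> \<inter> fst \<kappa>'))
        (\<lambda>p. snd \<kappa>' (inv_into (fst \<kappa>) (snd \<kappa>) p) $ a))"

definition smooth_manifold :: "'a topology \<Rightarrow> ('a, 'n::finite) chart set \<Rightarrow> bool" where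
  "smooth_manifold X A \<longleftrightarrow> Hausdorff_space X \<and> second_countable X \<and> smooth_atlas X A"

definition coord_rep :: "('a, 'n::finite) chart \<Rightarrow> ('a \<Rightarrow> real) \<Rightarrow> real^'n \<Rightarrow> real" where
  "coord_rep \<kappa> f = f \<circ> inv_into (fst \<kappa>) (snd \<kappa>)"

text \<open>The coordinate derivative of \<open>f\<close>, as a function on the chart domain.\<close>

definition pd :: "('a, 'n::finite) chart \<Rightarrow> 'n \<Rightarrow> ('a \<Rightarrow> real) \<Rightarrow> 'a \<Rightarrow> real" where
  "pd \<kappa> a f x = partial a (coord_rep \<kappa> f) (snd \<kappa> x)"

definition smooth_in :: "('a, 'n::finite) chart \<Rightarrow> 'a set \<Rightarrow> ('a \<Rightarrow> real) \<Rightarrow> bool" where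
  "smooth_in \<kappa> U f \<longleftrightarrow> smooth_on (snd \<kappa> ` (fst \<kappa> \<inter> U)) (coord_rep \<kappa> f)"

definition smooth_fun :: "('a, 'n::finite) chart set \<Rightarrow> 'a set \<Rightarrow> ('a \<Rightarrow> real) \<Rightarrow> bool" where
  "smooth_fun A U f \<longleftrightarrow> (\<forall>\<kappa>\<in>A. smooth_in \<kappa> U f)"

section \<open>Metrics and curvature\<close>

text \<open>Tensor fields are given by their components in every chart of the atlas: \<open>g \<kappa> x $ a $ b\<close> is
  \<open>g\<^sub>a\<^sub>b\<close> at \<open>x\<close> with respect to the coordinates \<open>\<kappa>\<close>. The signature is arbitrary.\<close>

type_synonym ('a, 'n) metric = "('a, 'n) chart \<Rightarrow> 'a \<Rightarrow> real^'n^'n"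

definition is_metric :: "('a, 'n::finite) chart set \<Rightarrow> ('a, 'n) metric \<Rightarrow> bool" where
  "is_metric A g \<longleftrightarrow>
     (\<forall>\<kappa>\<in>A. \<forall>a b. smooth_in \<kappa> (fst \<kappa>) (\<lambda>x. g \<kappa> x $ a $ b)) \<and>
     (\<forall>\<kappa>\<in>A. \<forall>x\<in>fst \<kappa>. transpose (g \<kappa> x) = g \<kappa> x \<and> invertible (g \<kappa> x)) \<and>
     (\<forall>\<kappa>\<in>A. \<forall>\<kappa>'\<in>A. \<forall>x\<in>fst \<kappa> \<inter> fst \<kappa>'. \<forall>a b.
        g \<kappa>' x $ a $ b =
          (\<Sum>c\<in>UNIV. \<Sum>d\<in>UNIV. pd \<kappa>' a (\<lambda>y. snd \<kappa> y $ c) x * pd \<kappa>' b (\<lambda>y. snd \<kappa> y $ d) x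
             * g \<kappa> x $ c $ d))"

definition ginv :: "('a, 'n::finite) metric \<Rightarrow> ('a, 'n) chart \<Rightarrow> 'a \<Rightarrow> real^'n^'n" where
  "ginv g \<kappa> x = matrix_inv (g \<kappa> x)"

text \<open>The Levi-Civita connection: \<open>christoffel g \<kappa> c a b\<close> is \<open>\<Gamma>\<^sup>c\<^sub>a\<^sub>b\<close>, so that
  \<open>\<nabla>\<^sub>a V\<^sup>c = \<partial>\<^sub>a V\<^sup>c + \<Gamma>\<^sup>c\<^sub>a\<^sub>b V\<^sup>b\<close>.\<close>

definition christoffel ::
    "('a, 'n::finite) metric \<Rightarrow> ('a, 'n) chart \<Rightarrow> 'n \<Rightarrow> 'n \<Rightarrow> 'n \<Rightarrow> 'a \<Rightarrow> real" where
  "christoffel g \<kappa> c a b x =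
     (1/2) * (\<Sum>d\<in>UNIV. ginv g \<kappa> x $ c $ d *
        (pd \<kappa> a (\<lambda>y. g \<kappa> y $ b $ d) x + pd \<kappa> b (\<lambda>y. g \<kappa> y $ a $ d) x
         - pd \<kappa> d (\<lambda>y. g \<kappa> y $ a $ b) x))"

lemma sum_matrix_inv:
  fixes h :: "real^'n::finite^'n"
  assumes "invertible h"
  shows "(\<Sum>e\<in>UNIV. h $ c $ e * (\<Sum>d\<in>UNIV. matrix_inv h $ e $ d * v d)) = v c"
proof -
  have "h ** matrix_inv h = mat 1"
    using assms someI_ex[of "\<lambda>B. h ** B = mat 1 \<and> B ** h = mat 1"]
    unfolding invertible_def matrix_inv_def by blast
  then have "h *v (matrix_inv h *v (\<chi> d. v d)) = (\<chi> d. v d)"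
    by (simp add: matrix_vector_mul_assoc)
  from this[THEN arg_cong, of "\<lambda>w. w $ c"] show ?thesis
    by (simp add: matrix_vector_mult_def)
qed

lemma pd_cong:
  assumes "open (snd \<kappa> ` fst \<kappa>)" "x \<in> fst \<kappa>" "\<And>y. y \<in> fst \<kappa> \<Longrightarrow> f y = h y"
  shows "pd \<kappa> a f x = pd \<kappa> a h x"
proof -
  have eq: "coord_rep \<kappa> f p = coord_rep \<kappa> h p" if "p \<in> snd \<kappa> ` fst \<kappa>" for p
    using that assms(3) by (auto simp: coord_rep_def intro!: assms(3) inv_into_into)
  have "(coord_rep \<kappa> f has_derivative D) (at (snd \<kappa> x)) \<longleftrightarrow>
        (coord_rep \<kappa> h has_derivative D) (at (snd \<kappa> x))" for D
    using has_derivative_transform_within_open[of "coord_rep \<kappa> f" D "snd \<kappa> x" UNIV "snd \<kappa> ` fst \<kappa>" "coord_rep \<kappa> h"]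
      has_derivative_transform_within_open[of "coord_rep \<kappa> h" D "snd \<kappa> x" UNIV "snd \<kappa> ` fst \<kappa>" "coord_rep \<kappa> f"]
      assms(1,2) eq by auto
  then show ?thesis
    by (simp add: pd_def partial_def frechet_derivative_def)
qed

text \<open>The two characteristic properties of the Levi-Civita connection.\<close>

lemma christoffel_torsion_free:
  assumes "open (snd \<kappa> ` fst \<kappa>)" "is_metric A g" "\<kappa> \<in> A" "x \<in> fst \<kappa>"
  shows "christoffel g \<kappa> c a b x = christoffel g \<kappa> c b a x"
proof -
  have "g \<kappa> y $ a $ b = g \<kappa> y $ b $ a" if "y \<in> fst \<kappa>" for y
  proof -
    have "transpose (g \<kappa> y) = g \<kappa> y"
      using assms that unfolding is_metric_def by blast
    from this[THEN arg_cong, of "\<lambda>m. m $ b $ a"] show ?thesis by (simp add: transpose_def)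
  qed
  then have "pd \<kappa> d (\<lambda>y. g \<kappa> y $ a $ b) x = pd \<kappa> d (\<lambda>y. g \<kappa> y $ b $ a) x" for d
    by (intro pd_cong[OF assms(1,4)])
  then show ?thesis by (simp add: christoffel_def add.commute)
qed

lemma christoffel_metric:
  assumes "open (snd \<kappa> ` fst \<kappa>)" "is_metric A g" "\<kappa> \<in> A" "x \<in> fst \<kappa>"
  shows "pd \<kappa> a (\<lambda>y. g \<kappa> y $ b $ c) x =
    (\<Sum>e\<in>UNIV. g \<kappa> x $ c $ e * christoffel g \<kappa> e a b x)
    + (\<Sum>e\<in>UNIV. g \<kappa> x $ b $ e * christoffel g \<kappa> e a c x)"
proof -
  have sym: "g \<kappa> y $ p $ q = g \<kappa> y $ q $ p" if "y \<in> fst \<kappa>" for y p q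
  proof -
    have "transpose (g \<kappa> y) = g \<kappa> y"
      using assms that unfolding is_metric_def by blast
    from this[THEN arg_cong, of "\<lambda>m. m $ q $ p"] show ?thesis by (simp add: transpose_def)
  qed
  have pds: "pd \<kappa> d (\<lambda>y. g \<kappa> y $ p $ q) x = pd \<kappa> d (\<lambda>y. g \<kappa> y $ q $ p) x" for d p q
    by (intro pd_cong[OF assms(1,4)] sym)
  have inv: "invertible (g \<kappa> x)"
    using assms unfolding is_metric_def by blast
  have lower: "(\<Sum>e\<in>UNIV. g \<kappa> x $ r $ e * christoffel g \<kappa> e p q x) =
     (1/2) * (pd \<kappa> p (\<lambda>y. g \<kappa> y $ q $ r) x + pd \<kappa> q (\<lambda>y. g \<kappa> y $ p $ r) x
         - pd \<kappa> r (\<lambda>y. g \<kappa> y $ p $ q) x)" for p q r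
  proof -
    have "(\<Sum>e\<in>UNIV. g \<kappa> x $ r $ e * christoffel g \<kappa> e p q x) =
      (1/2) * (\<Sum>e\<in>UNIV. g \<kappa> x $ r $ e * (\<Sum>d\<in>UNIV. matrix_inv (g \<kappa> x) $ e $ d *
        (pd \<kappa> p (\<lambda>y. g \<kappa> y $ q $ d) x + pd \<kappa> q (\<lambda>y. g \<kappa> y $ p $ d) x
         - pd \<kappa> d (\<lambda>y. g \<kappa> y $ p $ q) x)))"
      unfolding christoffel_def ginv_def
      by (subst sum_distrib_left[of "1/2"], intro sum.cong refl) (simp only: mult.left_commute)
    then show ?thesis by (simp only: sum_matrix_inv[OF inv])
  qed
  show ?thesis
    unfolding lower using pds[of a c b] pds[of b a c] pds[of c a b] by (simp add: field_simps)
qed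

text \<open>\<open>\<nabla>\<^sub>a V\<^sup>c\<close>, \<open>\<nabla>\<^sub>a \<mu>\<^sub>b\<close> and \<open>\<nabla>\<^sub>a T\<^sub>b\<^sup>c\<close>, the last for \<open>T b c = T\<^sub>b\<^sup>c\<close>.\<close>

definition cov_vec ::
    "('a, 'n::finite) metric \<Rightarrow> ('a, 'n) chart \<Rightarrow> 'n \<Rightarrow> ('n \<Rightarrow> 'a \<Rightarrow> real) \<Rightarrow> 'n \<Rightarrow> 'a \<Rightarrow> real" where
  "cov_vec g \<kappa> a V c x = pd \<kappa> a (V c) x + (\<Sum>e\<in>UNIV. christoffel g \<kappa> c a e x * V e x)"

definition cov_form ::
    "('a, 'n::finite) metric \<Rightarrow> ('a, 'n) chart \<Rightarrow> 'n \<Rightarrow> ('n \<Rightarrow> 'a \<Rightarrow> real) \<Rightarrow> 'n \<Rightarrow> 'a \<Rightarrow> real" where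
  "cov_form g \<kappa> a \<mu> b x = pd \<kappa> a (\<mu> b) x - (\<Sum>e\<in>UNIV. christoffel g \<kappa> e a b x * \<mu> e x)"

definition cov_mixed ::
    "('a, 'n::finite) metric \<Rightarrow> ('a, 'n) chart \<Rightarrow> 'n \<Rightarrow> ('n \<Rightarrow> 'n \<Rightarrow> 'a \<Rightarrow> real) \<Rightarrow>
       'n \<Rightarrow> 'n \<Rightarrow> 'a \<Rightarrow> real" where
  "cov_mixed g \<kappa> a T b c x =
     pd \<kappa> a (T b c) x + (\<Sum>e\<in>UNIV. christoffel g \<kappa> c a e x * T b e x)
       - (\<Sum>e\<in>UNIV. christoffel g \<kappa> e a b x * T e c x)"

text \<open>\<open>curv_up g \<kappa> a b c d\<close> is the component \<open>R\<^sub>a\<^sub>b\<^sup>c\<^sub>d\<close> defined by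
  \<open>(\<nabla>\<^sub>a\<nabla>\<^sub>b - \<nabla>\<^sub>b\<nabla>\<^sub>a) V\<^sup>c = R\<^sub>a\<^sub>b\<^sup>c\<^sub>d V\<^sup>d\<close>: the commutator is tensorial in \<open>V\<close>, so the component is its
  value on the \<open>d\<close>-th coordinate vector field.\<close>

definition coord_field :: "'n \<Rightarrow> 'n \<Rightarrow> 'a \<Rightarrow> real" where
  "coord_field d e x = (if e = d then 1 else 0)"

definition curv_up ::
    "('a, 'n::finite) metric \<Rightarrow> ('a, 'n) chart \<Rightarrow> 'n \<Rightarrow> 'n \<Rightarrow> 'n \<Rightarrow> 'n \<Rightarrow> 'a \<Rightarrow> real" where
  "curv_up g \<kappa> a b c d x =
     cov_mixed g \<kappa> a (\<lambda>b. cov_vec g \<kappa> b (coord_field d)) b c x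
     - cov_mixed g \<kappa> b (\<lambda>a. cov_vec g \<kappa> a (coord_field d)) a c x"

definition curv ::
    "('a, 'n::finite) metric \<Rightarrow> ('a, 'n) chart \<Rightarrow> 'n \<Rightarrow> 'n \<Rightarrow> 'n \<Rightarrow> 'n \<Rightarrow> 'a \<Rightarrow> real" where
  "curv g \<kappa> a b c d x = (\<Sum>e\<in>UNIV. g \<kappa> x $ c $ e * curv_up g \<kappa> a b e d x)"

definition totally_trace_free :: "real^'n^'n \<Rightarrow> ('n::finite \<Rightarrow> 'n \<Rightarrow> 'n \<Rightarrow> 'n \<Rightarrow> real) \<Rightarrow> bool" where
  "totally_trace_free h C \<longleftrightarrow> (\<forall>c d.
     (\<Sum>a\<in>UNIV. \<Sum>b\<in>UNIV. h $ a $ b * C a b c d) = 0 \<and>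
     (\<Sum>a\<in>UNIV. \<Sum>b\<in>UNIV. h $ a $ b * C a c b d) = 0 \<and>
     (\<Sum>a\<in>UNIV. \<Sum>b\<in>UNIV. h $ a $ b * C a c d b) = 0 \<and>
     (\<Sum>a\<in>UNIV. \<Sum>b\<in>UNIV. h $ a $ b * C c a b d) = 0 \<and>
     (\<Sum>a\<in>UNIV. \<Sum>b\<in>UNIV. h $ a $ b * C c a d b) = 0 \<and>
     (\<Sum>a\<in>UNIV. \<Sum>b\<in>UNIV. h $ a $ b * C c d a b) = 0)"

text \<open>\<open>R\<^sub>a\<^sub>b\<^sub>c\<^sub>d - 2 g\<^sub>c\<^sub>[\<^sub>a P\<^sub>b\<^sub>]\<^sub>d - 2 g\<^sub>d\<^sub>[\<^sub>b P\<^sub>a\<^sub>]\<^sub>c\<close> for a candidate Schouten tensor \<open>P\<close>.\<close>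

definition weyl_of ::
    "('a, 'n::finite) metric \<Rightarrow> ('a, 'n) chart \<Rightarrow> 'a \<Rightarrow> real^'n^'n \<Rightarrow> 'n \<Rightarrow> 'n \<Rightarrow> 'n \<Rightarrow> 'n \<Rightarrow> real" where
  "weyl_of g \<kappa> x P a b c d =
     curv g \<kappa> a b c d x
     - (g \<kappa> x $ c $ a * P $ b $ d - g \<kappa> x $ c $ b * P $ a $ d)
     - (g \<kappa> x $ d $ b * P $ a $ c - g \<kappa> x $ d $ a * P $ b $ c)"

text \<open>In dimension at least 3 exactly one symmetric \<open>P\<close> makes the remainder totally trace-free.\<close>

definition schouten :: "('a, 'n::finite) metric \<Rightarrow> ('a, 'n) chart \<Rightarrow> 'a \<Rightarrow> real^'n^'n" where
  "schouten g \<kappa> x =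
     (THE P. transpose P = P \<and> totally_trace_free (ginv g \<kappa> x) (weyl_of g \<kappa> x P))"

definition weyl ::
    "('a, 'n::finite) metric \<Rightarrow> ('a, 'n) chart \<Rightarrow> 'n \<Rightarrow> 'n \<Rightarrow> 'n \<Rightarrow> 'n \<Rightarrow> 'a \<Rightarrow> real" where
  "weyl g \<kappa> a b c d x = weyl_of g \<kappa> x (schouten g \<kappa> x) a b c d"

definition trace_schouten :: "('a, 'n::finite) metric \<Rightarrow> ('a, 'n) chart \<Rightarrow> 'a \<Rightarrow> real" where
  "trace_schouten g \<kappa> x =
     (\<Sum>a\<in>UNIV. \<Sum>b\<in>UNIV. ginv g \<kappa> x $ a $ b * schouten g \<kappa> x $ a $ b)"

definition laplacian ::
    "('a, 'n::finite) metric \<Rightarrow> ('a, 'n) chart \<Rightarrow> ('a \<Rightarrow> real) \<Rightarrow> 'a \<Rightarrow> real" where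
  "laplacian g \<kappa> f x =
     (\<Sum>a\<in>UNIV. \<Sum>b\<in>UNIV. ginv g \<kappa> x $ a $ b * cov_form g \<kappa> a (\<lambda>b. pd \<kappa> b f) b x)"

definition einstein :: "('a, 'n::finite) chart set \<Rightarrow> ('a, 'n) metric \<Rightarrow> bool" where
  "einstein A g \<longleftrightarrow> is_metric A g \<and>
     (\<forall>\<kappa>\<in>A. \<forall>x\<in>fst \<kappa>. \<forall>a b.
        schouten g \<kappa> x $ a $ b
          - (1 / real CARD('n)) * trace_schouten g \<kappa> x * g \<kappa> x $ a $ b = 0)"

section \<open>Conformal structures\<close>

definition rescales ::
    "('a, 'n::finite) chart set \<Rightarrow> ('a \<Rightarrow> real) \<Rightarrow> ('a, 'n) metric \<Rightarrow> ('a, 'n) metric \<Rightarrow> bool" where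
  "rescales A \<Omega> g g' \<longleftrightarrow>
     (\<forall>\<kappa>\<in>A. smooth_in \<kappa> (fst \<kappa>) \<Omega> \<and>
        (\<forall>x\<in>fst \<kappa>. \<Omega> x > 0 \<and> g' \<kappa> x = (\<Omega> x)\<^sup>2 *\<^sub>R g \<kappa> x))"

definition conformal_class ::
    "('a, 'n::finite) chart set \<Rightarrow> ('a, 'n) metric \<Rightarrow> ('a, 'n) metric set" where
  "conformal_class A g = {g'. is_metric A g' \<and> (\<exists>\<Omega>. rescales A \<Omega> g g')}"

definition conformal_manifold ::
    "'a topology \<Rightarrow> ('a, 'n::finite) chart set \<Rightarrow> ('a, 'n) metric set \<Rightarrow> bool" where
  "conformal_manifold X A \<C> \<longleftrightarrow>
     smooth_manifold X A \<and> (\<exists>g. is_metric A g \<and> \<C> = conformal_class A g)"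

definition conformally_einstein ::
    "('a, 'n::finite) chart set \<Rightarrow> ('a, 'n) metric set \<Rightarrow> bool" where
  "conformally_einstein A \<C> \<longleftrightarrow> (\<exists>g\<in>\<C>. einstein A g)"

text \<open>Here \<open>V\<close> is the component vector of a tangent vector at \<open>x\<close>. The condition does not depend on
  the metric in the class, as the tensor \<open>C\<^sub>a\<^sub>b\<^sub>c\<^sub>d\<close> only acquires the factor \<open>\<Omega>\<^sup>2\<close>.\<close>

definition weakly_generic ::
    "('a, 'n::finite) chart set \<Rightarrow> ('a, 'n) metric set \<Rightarrow> bool" where
  "weakly_generic A \<C> \<longleftrightarrow>
     (\<forall>g\<in>\<C>. \<forall>\<kappa>\<in>A. \<forall>x\<in>fst \<kappa>. \<forall>V::real^'n.
        (\<forall>a b c. (\<Sum>d\<in>UNIV. weyl g \<kappa> a b c d x * V $ d) = 0) \<longrightarrow> V = 0)"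

text \<open>Sections of \<open>\<E>[w]\<close> over \<open>U\<close>. The clause with \<open>\<Omega> = 1\<close> also forces equal values on metrics
  that agree on the manifold and differ only in the irrelevant values off chart domains.\<close>

type_synonym ('a, 'n) density = "('a, 'n) metric \<Rightarrow> 'a \<Rightarrow> real"

definition density_on ::
    "('a, 'n::finite) chart set \<Rightarrow> ('a, 'n) metric set \<Rightarrow> real \<Rightarrow> 'a set \<Rightarrow> ('a, 'n) density \<Rightarrow> bool" where
  "density_on A \<C> w U f \<longleftrightarrow>
     (\<forall>g\<in>\<C>. smooth_fun A U (f g)) \<and>
     (\<forall>g\<in>\<C>. \<forall>g'\<in>\<C>. \<forall>\<Omega>. rescales A \<Omega> g g' \<longrightarrow> (\<forall>x\<in>U. f g' x = \<Omega> x powr w * f g x))"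

text \<open>The metric \<open>\<sigma>\<^sup>-\<^sup>2 \<^bold>g\<close> computed in the scale \<open>g\<close>, where the tautological \<open>\<^bold>g\<close> takes the value
  \<open>g\<close>. It has weight 0, so it does not depend on \<open>g\<close>.\<close>

definition scale_metric :: "('a, 'n::finite) density \<Rightarrow> ('a, 'n) metric \<Rightarrow> ('a, 'n) metric" where
  "scale_metric \<sigma> g = (\<lambda>\<kappa> x. inverse ((\<sigma> g x)\<^sup>2) *\<^sub>R g \<kappa> x)"

definition einstein_scale ::
    "'a topology \<Rightarrow> ('a, 'n::finite) chart set \<Rightarrow> ('a, 'n) metric set \<Rightarrow> ('a, 'n) density \<Rightarrow> bool" where
  "einstein_scale X A \<C> \<sigma> \<longleftrightarrow>
     density_on A \<C> 1 (topspace X) \<sigma> \<and>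
     (\<forall>g\<in>\<C>. \<forall>x\<in>topspace X. \<sigma> g x \<noteq> 0) \<and>
     (\<forall>g\<in>\<C>. scale_metric \<sigma> g \<in> \<C> \<and> einstein A (scale_metric \<sigma> g))"

section \<open>The standard tractor bundle\<close>

definition local_densities ::
    "'a topology \<Rightarrow> ('a, 'n::finite) chart set \<Rightarrow> ('a, 'n) metric set \<Rightarrow> real \<Rightarrow> 'a \<Rightarrow>
       ('a, 'n) density set" where
  "local_densities X A \<C> w x = {\<sigma>. \<exists>U. openin X U \<and> x \<in> U \<and> density_on A \<C> w U \<sigma>}"

definition same_1jet ::
    "('a, 'n::finite) chart set \<Rightarrow> ('a, 'n) metric set \<Rightarrow> 'a \<Rightarrow>
       ('a, 'n) density \<Rightarrow> ('a, 'n) density \<Rightarrow> bool" where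
  "same_1jet A \<C> x \<sigma> \<tau> \<longleftrightarrow>
     (\<forall>g\<in>\<C>. \<forall>\<kappa>\<in>A. x \<in> fst \<kappa> \<longrightarrow>
        \<sigma> g x = \<tau> g x \<and> (\<forall>a. pd \<kappa> a (\<sigma> g) x = pd \<kappa> a (\<tau> g) x))"

definition hessian_diff ::
    "('a, 'n::finite) metric \<Rightarrow> ('a, 'n) chart \<Rightarrow> 'a \<Rightarrow> ('a, 'n) density \<Rightarrow> ('a, 'n) density \<Rightarrow> real^'n^'n"
  where
  "hessian_diff g \<kappa> x \<sigma> \<tau> = (\<chi> a b. pd \<kappa> a (pd \<kappa> b (\<sigma> g)) x - pd \<kappa> a (pd \<kappa> b (\<tau> g)) x)"

definition jet2_rel ::
    "'a topology \<Rightarrow> ('a, 'n::finite) chart set \<Rightarrow> ('a, 'n) metric set \<Rightarrow> 'a \<Rightarrow>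
       (('a, 'n) density \<times> ('a, 'n) density) set" where
  "jet2_rel X A \<C> x = {(\<sigma>, \<tau>).
     \<sigma> \<in> local_densities X A \<C> 1 x \<and> \<tau> \<in> local_densities X A \<C> 1 x \<and> same_1jet A \<C> x \<sigma> \<tau> \<and>
     (\<forall>g\<in>\<C>. \<forall>\<kappa>\<in>A. x \<in> fst \<kappa> \<longrightarrow> hessian_diff g \<kappa> x \<sigma> \<tau> = 0)}"

text \<open>The fibre at \<open>x\<close> of the jet bundle \<open>J\<^sup>2\<E>[1]\<close>.\<close>

definition jet2_fibre ::
    "'a topology \<Rightarrow> ('a, 'n::finite) chart set \<Rightarrow> ('a, 'n) metric set \<Rightarrow> 'a \<Rightarrow>
       ('a, 'n) density set set" where
  "jet2_fibre X A \<C> x = local_densities X A \<C> 1 x // jet2_rel X A \<C> x"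

text \<open>Symmetric tensors of weight 1 embed into \<open>J\<^sup>2\<E>[1]\<close> as the 2-jets with vanishing 1-jet, the tensor
  being the matrix of second derivatives. Two 2-jets are related here if their difference is
  the image of a trace-free one.\<close>

definition tractor_rel ::
    "'a topology \<Rightarrow> ('a, 'n::finite) chart set \<Rightarrow> ('a, 'n) metric set \<Rightarrow> 'a \<Rightarrow>
       (('a, 'n) density set \<times> ('a, 'n) density set) set" where
  "tractor_rel X A \<C> x = {(j, k).
     j \<in> jet2_fibre X A \<C> x \<and> k \<in> jet2_fibre X A \<C> x \<and>
     (\<exists>\<sigma>\<in>j. \<exists>\<tau>\<in>k. same_1jet A \<C> x \<sigma> \<tau> \<and>
        (\<forall>g\<in>\<C>. \<forall>\<kappa>\<in>A. x \<in> fst \<kappa> \<longrightarrow>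
           transpose (hessian_diff g \<kappa> x \<sigma> \<tau>) = hessian_diff g \<kappa> x \<sigma> \<tau> \<and>
           (\<Sum>a\<in>UNIV. \<Sum>b\<in>UNIV. ginv g \<kappa> x $ a $ b * hessian_diff g \<kappa> x \<sigma> \<tau> $ a $ b) = 0))}"

type_synonym ('a, 'n) tractor = "('a, 'n) density set set"

definition tractor_fibre ::
    "'a topology \<Rightarrow> ('a, 'n::finite) chart set \<Rightarrow> ('a, 'n) metric set \<Rightarrow> 'a \<Rightarrow> ('a, 'n) tractor set" where
  "tractor_fibre X A \<C> x = jet2_fibre X A \<C> x // tractor_rel X A \<C> x"

definition tractor_class ::
    "'a topology \<Rightarrow> ('a, 'n::finite) chart set \<Rightarrow> ('a, 'n) metric set \<Rightarrow> 'a \<Rightarrow>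
       ('a, 'n) density \<Rightarrow> ('a, 'n) tractor" where
  "tractor_class X A \<C> x \<sigma> = tractor_rel X A \<C> x `` {jet2_rel X A \<C> x `` {\<sigma>}}"

definition zero_tractor ::
    "'a topology \<Rightarrow> ('a, 'n::finite) chart set \<Rightarrow> ('a, 'n) metric set \<Rightarrow> 'a \<Rightarrow> ('a, 'n) tractor" where
  "zero_tractor X A \<C> x = tractor_class X A \<C> x (\<lambda>_ _. 0)"

text \<open>The splitting \<open>(\<sigma>, \<nabla>\<^sub>a\<sigma>, - (1/n) (\<Delta> + J) \<sigma>)\<close> of a tractor at \<open>x\<close> determined by \<open>g\<close>, with the
  densities trivialised by \<open>g\<close>. The components do not depend on the representative.\<close>

definition representative :: "('a, 'n::finite) tractor \<Rightarrow> ('a, 'n) density" where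
  "representative t = (SOME \<sigma>. \<exists>j\<in>t. \<sigma> \<in> j)"

definition splitting ::
    "('a, 'n::finite) metric \<Rightarrow> ('a, 'n) chart \<Rightarrow> 'a \<Rightarrow> ('a, 'n) tractor \<Rightarrow>
       real \<times> (real^'n) \<times> real" where
  "splitting g \<kappa> x t = (let \<sigma> = representative t g in
     (\<sigma> x, \<chi> a. pd \<kappa> a \<sigma> x,
      - (1 / real CARD('n)) * (laplacian g \<kappa> \<sigma> x + trace_schouten g \<kappa> x * \<sigma> x)))"

definition X_proj :: "('a \<Rightarrow> ('a, 'n::finite) tractor) \<Rightarrow> ('a, 'n) density" where
  "X_proj \<I> = (\<lambda>g x. representative (\<I> x) g x)"

lemma fst_splitting: "fst (splitting g \<kappa> x (\<I> x)) = X_proj \<I> g x"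
  by (simp add: splitting_def X_proj_def Let_def)

text \<open>Smooth sections of the tractor bundle.\<close>

definition tractor_field ::
    "'a topology \<Rightarrow> ('a, 'n::finite) chart set \<Rightarrow> ('a, 'n) metric set \<Rightarrow> ('a \<Rightarrow> ('a, 'n) tractor) \<Rightarrow> bool"
  where
  "tractor_field X A \<C> \<I> \<longleftrightarrow>
     (\<forall>x\<in>topspace X. \<I> x \<in> tractor_fibre X A \<C> x) \<and>
     (\<forall>g\<in>\<C>. \<forall>\<kappa>\<in>A.
        smooth_in \<kappa> (fst \<kappa>) (\<lambda>x. fst (splitting g \<kappa> x (\<I> x))) \<and>
        (\<forall>a. smooth_in \<kappa> (fst \<kappa>) (\<lambda>x. fst (snd (splitting g \<kappa> x (\<I> x))) $ a)) \<and>
        smooth_in \<kappa> (fst \<kappa>) (\<lambda>x. snd (snd (splitting g \<kappa> x (\<I> x)))))"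

text \<open>\<open>\<nabla>\<^sub>a (\<sigma>, \<mu>\<^sub>b, \<rho>)\<close> in the splitting determined by \<open>g\<close>.\<close>

definition tractor_connection ::
    "('a, 'n::finite) metric \<Rightarrow> ('a, 'n) chart \<Rightarrow> 'n \<Rightarrow> ('a \<Rightarrow> real \<times> (real^'n) \<times> real) \<Rightarrow>
       'a \<Rightarrow> real \<times> (real^'n) \<times> real" where
  "tractor_connection g \<kappa> a S x =
     (let \<sigma> = (\<lambda>y. fst (S y)); \<mu> = (\<lambda>b y. fst (snd (S y)) $ b); \<rho> = (\<lambda>y. snd (snd (S y))) in
      (pd \<kappa> a \<sigma> x - \<mu> a x,
       \<chi> b. cov_form g \<kappa> a \<mu> b x + g \<kappa> x $ a $ b * \<rho> x + schouten g \<kappa> x $ a $ b * \<sigma> x,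
       pd \<kappa> a \<rho> x
         - (\<Sum>b\<in>UNIV. schouten g \<kappa> x $ a $ b * (\<Sum>c\<in>UNIV. ginv g \<kappa> x $ b $ c * \<mu> c x))))"

definition parallel_tractor ::
    "'a topology \<Rightarrow> ('a, 'n::finite) chart set \<Rightarrow> ('a, 'n) metric set \<Rightarrow> ('a \<Rightarrow> ('a, 'n) tractor) \<Rightarrow> bool"
  where
  "parallel_tractor X A \<C> \<I> \<longleftrightarrow>
     tractor_field X A \<C> \<I> \<and>
     (\<forall>g\<in>\<C>. \<forall>\<kappa>\<in>A. \<forall>x\<in>fst \<kappa>. \<forall>a.
        tractor_connection g \<kappa> a (\<lambda>y. splitting g \<kappa> y (\<I> y)) x = (0, 0, 0))"

end

theory Submission
  imports Defs
begin

text \<open>In a chart write \<open>\<I> = (\<sigma>, \<mu>\<^sub>a, \<rho>)\<close>. Commuting derivatives of \<open>\<mu>\<close> in the parallel equations gives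
  \<open>C\<^sub>a\<^sub>b\<^sub>c\<^sub>d \<mu>\<^sup>d = - \<sigma> A\<^sub>a\<^sub>b\<^sub>c\<close> with \<open>A\<close> the Cotton tensor. At a zero of \<open>\<sigma>\<close> weak genericity forces \<open>\<mu> = 0\<close>,
  and differentiating the identity there leaves \<open>\<rho> C = 0\<close>, so \<open>\<rho> = 0\<close> as well and \<open>\<I>\<close> vanishes. As
  \<open>\<I>\<close> solves a linear first-order system, its zero set is open and closed, hence empty.

  Weak genericity and the parallel equations hold for every metric of the class, which replaces all
  conformal transformation formulas: in the scale \<open>g = \<sigma>\<^sup>-\<^sup>2 \<^bold>g\<close> the component \<open>\<sigma>\<close> is \<open>\<plusminus>1\<close>, so \<open>\<mu> = 0\<close> and the
  middle equation reads \<open>P\<^sub>a\<^sub>b = - \<sigma> \<rho> g\<^sub>a\<^sub>b\<close>.\<close>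

section \<open>Calculus of smooth functions\<close>

text \<open>Neither jet classes nor the definite description \<open>schouten\<close> can be
  differentiated as they stand. So \<open>schouten\<close> is first identified with a Ricci
  expression; with Cramer's rule for the inverse metric, this makes P, C and A smooth. The parallel
  equations are then studied as a system for real functions in one chart and one scale, and jets
  return only to turn vanishing components into \<open>zero_tractor\<close>.

  Weak genericity acts twice at a zero of \<sigma>. The second time only its consequence that C is
  non-zero there matters: if \<rho> were non-zero, C would annihilate every coordinate vector.
  Differentiating the identity brings in derivatives of C and A, but these carry the factors \<mu>
  and \<sigma>, which vanish at the point.

  Symmetry of second derivatives is used three times: for the curvature symmetries, for commuting
  derivatives of \<mu>, and for the Hessian of a representative of a tractor.\<close>

lemma partial_has_derivative:
  assumes "(f has_derivative D) (at p)"
  shows "partial a f p = D (axis a 1)"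
  using frechet_derivative_at[OF assms] by (simp add: partial_def)

lemma has_derivative_partial:
  fixes f :: "real^'n::finite \<Rightarrow> real"
  assumes "f differentiable (at p)"
  shows "(f has_derivative (\<lambda>v. \<Sum>a\<in>UNIV. v $ a * partial a f p)) (at p)"
proof -
  have D: "(f has_derivative frechet_derivative f (at p)) (at p)"
    using assms frechet_derivative_works by blast
  have lin: "linear (frechet_derivative f (at p))"
    using assms linear_frechet_derivative by blast
  have "frechet_derivative f (at p) v = (\<Sum>a\<in>UNIV. v $ a * partial a f p)" for v
  proof -
    have "v = (\<Sum>a\<in>UNIV. v $ a *\<^sub>R axis a 1)"
      by (metis basis_expansion scalar_mult_eq_scaleR)
    then have "frechet_derivative f (at p) v = frechet_derivative f (at p) (\<Sum>a\<in>UNIV. v $ a *\<^sub>R axis a 1)"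
      by simp
    also have "\<dots> = (\<Sum>a\<in>UNIV. v $ a * partial a f p)"
      by (simp add: linear_sum[OF lin] linear_scale[OF lin] partial_def)
    finally show ?thesis .
  qed
  then show ?thesis using D by (metis (no_types, lifting) ext)
qed

text \<open>No differentiability is assumed: \<open>f\<close> and \<open>h\<close> admit the same
  derivatives at \<open>p\<close>, so the choice made by \<open>frechet_derivative\<close> agrees
  for both even where none exists.\<close>

lemma partial_transform_open:
  assumes "open S" "p \<in> S" "\<And>q. q \<in> S \<Longrightarrow> f q = h q"
  shows "partial a f p = partial a h p"
proof -
  have "(f has_derivative D) (at p) \<longleftrightarrow> (h has_derivative D) (at p)" for D
    using has_derivative_transform_within_open[of f D p UNIV S h]
      has_derivative_transform_within_open[of h D p UNIV S f] assms by auto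
  then show ?thesis by (simp add: partial_def frechet_derivative_def)
qed

lemma differentiable_transform_open:
  assumes "open S" "p \<in> S" "\<And>q. q \<in> S \<Longrightarrow> f q = h q" "f differentiable (at p)"
  shows "h differentiable (at p)"
  using has_derivative_transform_within_open[of f _ p UNIV S h] assms
  unfolding differentiable_def by blast

lemma smooth_on_differentiable: "smooth_on S f \<Longrightarrow> p \<in> S \<Longrightarrow> f differentiable (at p)"
  unfolding smooth_on_def by (metis foldr.simps(1) id_apply)

lemma smooth_on_partial:
  assumes "smooth_on S f"
  shows "smooth_on S (partial a f)"
  unfolding smooth_on_def
proof (intro allI ballI)
  fix as p assume "p \<in> S"
  \<comment> \<open>\<open>foldr\<close> applies the last list entry first, so appending
    \<open>a\<close> makes it the innermost derivative.\<close>
  then have "foldr partial (as @ [a]) f differentiable (at p)"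
    using assms unfolding smooth_on_def by blast
  then show "foldr partial as (partial a f) differentiable (at p)" by simp
qed

text \<open>The algebra generated by the smooth functions is closed under partial derivatives, so each of
  its members is smooth.\<close>

inductive generated :: "(real^'n::finite) set \<Rightarrow> (real^'n \<Rightarrow> real) \<Rightarrow> bool" for S where
  base: "smooth_on S f \<Longrightarrow> generated S f"
| const: "generated S (\<lambda>p. c)"
| add: "generated S f \<Longrightarrow> generated S h \<Longrightarrow> generated S (\<lambda>p. f p + h p)"
| mult: "generated S f \<Longrightarrow> generated S h \<Longrightarrow> generated S (\<lambda>p. f p * h p)"
| inverse: "generated S f \<Longrightarrow> (\<And>p. p \<in> S \<Longrightarrow> f p \<noteq> 0) \<Longrightarrow> generated S (\<lambda>p. inverse (f p))"
| abs: "generated S f \<Longrightarrow> (\<And>p. p \<in> S \<Longrightarrow> f p \<noteq> 0) \<Longrightarrow> generated S (\<lambda>p. \<bar>f p\<bar>)"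
| cong: "generated S f \<Longrightarrow> (\<And>p. p \<in> S \<Longrightarrow> f p = h p) \<Longrightarrow> generated S h"

lemma partial_add:
  assumes "f differentiable (at p)" "h differentiable (at p)"
  shows "partial a (\<lambda>p. f p + h p) p = partial a f p + partial a h p"
  using partial_has_derivative[OF has_derivative_add[OF assms[THEN frechet_derivative_works[THEN iffD1]]]]
  by (simp add: partial_def)

lemma partial_mult:
  fixes f h :: "real^'n::finite \<Rightarrow> real"
  assumes "f differentiable (at p)" "h differentiable (at p)"
  shows "partial a (\<lambda>p. f p * h p) p = partial a f p * h p + f p * partial a h p"
  using partial_has_derivative[OF has_derivative_mult[OF assms[THEN frechet_derivative_works[THEN iffD1]]]]
  by (simp add: partial_def)

lemma partial_inverse:
  fixes f :: "real^'n::finite \<Rightarrow> real"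
  assumes "f differentiable (at p)" "f p \<noteq> 0"
  shows "partial a (\<lambda>p. inverse (f p)) p = (-1) * (inverse (f p) * (partial a f p * inverse (f p)))"
  using partial_has_derivative[OF Deriv.has_derivative_inverse[OF assms(2) frechet_derivative_works[THEN iffD1, OF assms(1)]]]
  by (simp add: partial_def)

text \<open>Needed for the scale factor \<open>inverse \<bar>\<sigma>\<bar>\<close>, since a nowhere
  vanishing \<sigma> may be negative. As in \<open>partial_inverse\<close>, the derivative is
  written with constructors of \<open>generated\<close> only, hence without
  \<open>sgn\<close>.\<close>

lemma partial_abs:
  fixes f :: "real^'n::finite \<Rightarrow> real"
  assumes "f differentiable (at p)" "f p \<noteq> 0"
  shows "(\<lambda>p. \<bar>f p\<bar>) differentiable (at p)"
    and "partial a (\<lambda>p. \<bar>f p\<bar>) p = \<bar>f p\<bar> * inverse (f p) * partial a f p"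
proof -
  have D: "((\<lambda>p. \<bar>f p\<bar>) has_derivative (\<lambda>v. frechet_derivative f (at p) v * sgn (f p))) (at p)"
    using has_derivative_compose[OF frechet_derivative_works[THEN iffD1, OF assms(1)]
        has_derivative_norm[OF assms(2)]] by simp
  then show "(\<lambda>p. \<bar>f p\<bar>) differentiable (at p)"
    and "partial a (\<lambda>p. \<bar>f p\<bar>) p = \<bar>f p\<bar> * inverse (f p) * partial a f p"
    using partial_has_derivative[OF D, of a] D assms(2)
    by (auto simp: differentiable_def partial_def[of a f] sgn_if field_simps)
qed

lemma partial_const [simp]: "partial a (\<lambda>p. c) p = 0"
  by (simp add: partial_def)

text \<open>Both parts go through one induction because the rules for sums, products, inverses and
  absolute values need differentiability of the constituents. The rules are available only at points
  of \<open>S\<close>; \<open>generated.cong\<close> makes that sufficient.\<close>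

lemma generated_partial:
  assumes "open S" "generated S f"
  shows "(\<forall>p\<in>S. f differentiable (at p)) \<and> (\<forall>a. generated S (partial a f))"
  using assms(2)
proof (induction rule: generated.induct)
  case (base f)
  then show ?case using smooth_on_differentiable smooth_on_partial generated.base by blast
next
  case (const c)
  have "generated S (partial a (\<lambda>p. c))" for a
    by (rule generated.cong[OF generated.const[of S 0]]) simp
  then show ?case by (metis differentiable_const)
next
  case (add f h)
  have "generated S (partial a (\<lambda>p. f p + h p))" for a
    by (rule generated.cong[OF generated.add[of S "partial a f" "partial a h"]])
      (use add in \<open>auto simp: partial_add\<close>)
  then show ?case using add by auto
next
  case (mult f h)
  have "generated S (partial a (\<lambda>p. f p * h p))" for a
    by (rule generated.cong[OF generated.add[OF generated.mult[of S "partial a f" h] generated.mult[of S f "partial a h"]]])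
      (use mult in \<open>auto simp: partial_mult\<close>)
  then show ?case using mult by auto
next
  case (inverse f)
  have i: "generated S (\<lambda>p. inverse (f p))"
    using inverse by (intro generated.inverse) auto
  have "generated S (partial a (\<lambda>p. inverse (f p)))" for a
    by (rule generated.cong[OF generated.mult[OF generated.const[of S "-1"]
              generated.mult[OF i generated.mult[of S "partial a f", OF _ i]]]])
      (use inverse in \<open>auto simp: partial_inverse\<close>)
  then show ?case using inverse
    by (auto intro!: differentiable_inverse simp: field_differentiable_def)
next
  case (abs f)
  have "generated S (partial a (\<lambda>p. \<bar>f p\<bar>))" for a
  proof (rule generated.cong)
    show "generated S (\<lambda>p. \<bar>f p\<bar> * inverse (f p) * partial a f p)"
      using abs by (intro generated.mult generated.abs generated.inverse) auto
  qed (use abs in \<open>auto simp: partial_abs\<close>)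
  then show ?case using abs partial_abs(1) by blast
next
  case (cong f h)
  have "generated S (partial a h)" for a
    by (rule generated.cong[of S "partial a f"])
      (use cong partial_transform_open[OF assms(1), of _ f h] in auto)
  then show ?case using cong differentiable_transform_open[OF assms(1), of _ f h] by blast
qed

lemma generated_smooth:
  assumes "open S" "generated S f"
  shows "smooth_on S f"
proof -
  have "generated S f \<Longrightarrow> \<forall>p\<in>S. foldr partial as f differentiable (at p)" for as and f :: "real^'a \<Rightarrow> real"
  \<comment> \<open>Induction from the right end, where \<open>foldr\<close> starts, applies the
    hypothesis to \<open>partial a f\<close>.\<close>
  proof (induction as arbitrary: f rule: rev_induct)
    case Nil
    then show ?case using generated_partial[OF assms(1)] by simp
  next
    case (snoc a as)
    then show ?case using generated_partial[OF assms(1)] by simp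
  qed
  then show ?thesis using assms(2) by (simp add: smooth_on_def)
qed

subsection \<open>Symmetry of second derivatives\<close>

text \<open>The second difference is an increment in direction \<open>a\<close> of a difference in
  direction \<open>b\<close>. The mean value theorem turns it into \<open>h\<close> times a
  difference of two values of \<open>partial a f\<close>, which differentiability of
  \<open>partial a f\<close> at \<open>p\<close> alone evaluates. The constant 3 adds the errors for
  displacements of length at most \<open>2 * h\<close> and \<open>h\<close>.\<close>

lemma second_difference:
  fixes f :: "real^'n::finite \<Rightarrow> real"
  assumes S: "open S" "p \<in> S"
    and f: "\<And>q. q \<in> S \<Longrightarrow> f differentiable (at q)"
    and w: "partial a f differentiable (at p)"
    and e: "e > 0"
  shows "\<exists>d>0. \<forall>h. 0 < h \<and> h < d \<longrightarrow>
    \<bar>f (p + h *\<^sub>R axis a 1 + h *\<^sub>R axis b 1) - f (p + h *\<^sub>R axis a 1) - f (p + h *\<^sub>R axis b 1) + f p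
       - h * h * partial b (partial a f) p\<bar> \<le> 3 * e * (h * h)"
proof -
  let ?u = "axis a 1 :: real^'n" and ?v = "axis b 1 :: real^'n"
  obtain r where r: "r > 0" "ball p r \<subseteq> S" using S openE by blast
  define D where "D = frechet_derivative (partial a f) (at p)"
  have D: "(partial a f has_derivative D) (at p)"
    using w frechet_derivative_works unfolding D_def by blast
  obtain d where d: "d > 0" "\<And>y. norm (y - p) < d \<Longrightarrow>
      \<bar>partial a f y - partial a f p - D (y - p)\<bar> \<le> e * norm (y - p)"
    using D e unfolding has_derivative_at_alt by (metis real_norm_def)
  have lin: "linear D" using D has_derivative_linear by blast
  \<comment> \<open>All points used lie within \<open>2 * h\<close> of \<open>p\<close>; the thirds
    keep them in \<open>S\<close> and in the range of the linear approximation.\<close>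
  define d' where "d' = min (r/3) (d/3)"
  have "\<bar>f (p + h *\<^sub>R ?u + h *\<^sub>R ?v) - f (p + h *\<^sub>R ?u) - f (p + h *\<^sub>R ?v) + f p
       - h * h * partial b (partial a f) p\<bar> \<le> 3 * e * (h * h)" if h: "0 < h" "h < d'" for h
  proof -
    have n1: "norm (t *\<^sub>R ?u) \<le> h" "norm (t *\<^sub>R ?u + h *\<^sub>R ?v) \<le> 2 * h" if "0 \<le> t" "t \<le> h" for t
      using that norm_triangle_ineq[of "t *\<^sub>R ?u" "h *\<^sub>R ?v"] by auto
    have inS: "p + t *\<^sub>R ?u \<in> S" "p + h *\<^sub>R ?v + t *\<^sub>R ?u \<in> S" if "0 \<le> t" "t \<le> h" for t
    proof -
      have "norm (t *\<^sub>R ?u) < r" "norm (h *\<^sub>R ?v + t *\<^sub>R ?u) < r"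
        using n1[OF that] h r by (auto simp: d'_def add.commute)
      then show "p + t *\<^sub>R ?u \<in> S" "p + h *\<^sub>R ?v + t *\<^sub>R ?u \<in> S"
        using r(2) by (auto simp: subset_iff dist_norm add.assoc norm_minus_commute)
    qed
    have der: "((\<lambda>t. f (q + t *\<^sub>R ?u)) has_derivative (\<lambda>s. s * partial a f (q + t *\<^sub>R ?u))) (at t within {0..h})"
      if "q + t *\<^sub>R ?u \<in> S" for q t
    proof -
      let ?F = "frechet_derivative f (at (q + t *\<^sub>R ?u))"
      have F: "(f has_derivative ?F) (at (q + t *\<^sub>R ?u))"
        using f[OF that] frechet_derivative_works by blast
      have "((\<lambda>t. q + t *\<^sub>R ?u) has_derivative (\<lambda>s. s *\<^sub>R ?u)) (at t within {0..h})"
        by (auto intro!: derivative_eq_intros)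
      from has_derivative_compose[OF this F]
      show ?thesis
        using linear_scale[OF has_derivative_linear[OF F]] by (simp add: partial_def)
    qed
    \<comment> \<open>The mean value theorem is applied to the difference of \<open>f\<close> along
      two parallel segments, so one \<open>t\<close> serves both values of
      \<open>partial a f\<close>.\<close>
    have "\<exists>t\<in>{0<..<h}. (f (p + h *\<^sub>R ?v + h *\<^sub>R ?u) - f (p + h *\<^sub>R ?u)) - (f (p + h *\<^sub>R ?v + 0 *\<^sub>R ?u) - f (p + 0 *\<^sub>R ?u))
        = (h - 0) * partial a f (p + h *\<^sub>R ?v + t *\<^sub>R ?u) - (h - 0) * partial a f (p + t *\<^sub>R ?u)"
      by (rule mvt_simple[OF h(1), of "\<lambda>t. f (p + h *\<^sub>R ?v + t *\<^sub>R ?u) - f (p + t *\<^sub>R ?u)"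
            "\<lambda>t s. s * partial a f (p + h *\<^sub>R ?v + t *\<^sub>R ?u) - s * partial a f (p + t *\<^sub>R ?u)"])
        (intro has_derivative_diff der inS; simp)
    then obtain t where t: "0 < t" "t < h" and
      eq: "f (p + h *\<^sub>R ?v + h *\<^sub>R ?u) - f (p + h *\<^sub>R ?u) - f (p + h *\<^sub>R ?v) + f p
        = h * (partial a f (p + h *\<^sub>R ?v + t *\<^sub>R ?u) - partial a f (p + t *\<^sub>R ?u))"
      by (auto simp: algebra_simps)
    have t': "0 \<le> t" "t \<le> h" using t by auto
    have lt: "norm (h *\<^sub>R ?v + t *\<^sub>R ?u) < d" "norm (t *\<^sub>R ?u) < d"
      using n1[OF t'] h d by (auto simp: d'_def add.commute)
    have A: "\<bar>partial a f (p + (h *\<^sub>R ?v + t *\<^sub>R ?u)) - partial a f p - D (h *\<^sub>R ?v + t *\<^sub>R ?u)\<bar> \<le> e * (2 * h)"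
    proof (rule order_trans)
      show "\<bar>partial a f (p + (h *\<^sub>R ?v + t *\<^sub>R ?u)) - partial a f p - D (h *\<^sub>R ?v + t *\<^sub>R ?u)\<bar>
          \<le> e * norm (h *\<^sub>R ?v + t *\<^sub>R ?u)"
        using d(2)[of "p + (h *\<^sub>R ?v + t *\<^sub>R ?u)"] lt(1) by simp
      show "e * norm (h *\<^sub>R ?v + t *\<^sub>R ?u) \<le> e * (2 * h)"
        using n1(2)[OF t'] e by (intro mult_left_mono) (auto simp: add.commute)
    qed
    have B: "\<bar>partial a f (p + t *\<^sub>R ?u) - partial a f p - D (t *\<^sub>R ?u)\<bar> \<le> e * h"
    proof (rule order_trans)
      show "\<bar>partial a f (p + t *\<^sub>R ?u) - partial a f p - D (t *\<^sub>R ?u)\<bar> \<le> e * norm (t *\<^sub>R ?u)"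
        using d(2)[of "p + t *\<^sub>R ?u"] lt(2) by simp
      show "e * norm (t *\<^sub>R ?u) \<le> e * h"
        using n1(1)[OF t'] e by (intro mult_left_mono) auto
    qed
    have "D (h *\<^sub>R ?v + t *\<^sub>R ?u) = h * partial b (partial a f) p + D (t *\<^sub>R ?u)"
      using linear_add[OF lin] linear_scale[OF lin] by (simp add: partial_def D_def)
    then have C: "\<bar>(partial a f (p + h *\<^sub>R ?v + t *\<^sub>R ?u) - partial a f (p + t *\<^sub>R ?u)) - h * partial b (partial a f) p\<bar> \<le> 3 * e * h"
      using A B by (simp add: add.assoc)
    have "\<bar>h * ((partial a f (p + h *\<^sub>R ?v + t *\<^sub>R ?u) - partial a f (p + t *\<^sub>R ?u)) - h * partial b (partial a f) p)\<bar> \<le> h * (3 * e * h)"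
      unfolding abs_mult using C h(1) by (intro mult_mono) auto
    moreover have "p + h *\<^sub>R ?u + h *\<^sub>R ?v = p + h *\<^sub>R ?v + h *\<^sub>R ?u" by (simp add: algebra_simps)
    ultimately show ?thesis using eq by (simp add: algebra_simps)
  qed
  moreover have "d' > 0" using r d by (simp add: d'_def)
  ultimately show ?thesis by blast
qed

lemma partial_commute:
  fixes f :: "real^'n::finite \<Rightarrow> real"
  assumes S: "open S" "p \<in> S" and f: "smooth_on S f"
  shows "partial a (partial b f) p = partial b (partial a f) p"
proof (rule ccontr)
  assume ne: "\<not> ?thesis"
  \<comment> \<open>Both mixed derivatives approximate the same second difference, so they differ by
    at most \<open>6 * e\<close>, which is half of the assumed gap.\<close>
  define e where "e = \<bar>partial a (partial b f) p - partial b (partial a f) p\<bar> / 12"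
  have e: "e > 0" using ne by (simp add: e_def)
  have df: "\<And>q. q \<in> S \<Longrightarrow> f differentiable (at q)" "\<And>c. partial c f differentiable (at p)"
    using smooth_on_differentiable f smooth_on_partial S(2) by blast+
  obtain d1 where d1: "d1 > 0" "\<And>h. 0 < h \<and> h < d1 \<Longrightarrow>
    \<bar>f (p + h *\<^sub>R axis a 1 + h *\<^sub>R axis b 1) - f (p + h *\<^sub>R axis a 1) - f (p + h *\<^sub>R axis b 1) + f p
       - h * h * partial b (partial a f) p\<bar> \<le> 3 * e * (h * h)"
    using second_difference[OF S df(1) df(2)[of a] e, of b] by blast
  obtain d2 where d2: "d2 > 0" "\<And>h. 0 < h \<and> h < d2 \<Longrightarrow>
    \<bar>f (p + h *\<^sub>R axis b 1 + h *\<^sub>R axis a 1) - f (p + h *\<^sub>R axis b 1) - f (p + h *\<^sub>R axis a 1) + f p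
       - h * h * partial a (partial b f) p\<bar> \<le> 3 * e * (h * h)"
    using second_difference[OF S df(1) df(2)[of b] e, of a] by blast
  define h where "h = min d1 d2 / 2"
  have h: "0 < h" "h < d1" "h < d2" using d1 d2 by (auto simp: h_def)
  have comm: "p + h *\<^sub>R axis b 1 + h *\<^sub>R axis a 1 = p + h *\<^sub>R axis a 1 + h *\<^sub>R axis b 1"
    by (simp add: algebra_simps)
  have "\<bar>h * h * partial a (partial b f) p - h * h * partial b (partial a f) p\<bar> \<le> 6 * e * (h * h)"
    using d1(2)[of h] d2(2)[of h] h unfolding comm by linarith
  then have "(h * h) * \<bar>partial a (partial b f) p - partial b (partial a f) p\<bar> \<le> (h * h) * (6 * e)"
    by (simp add: abs_mult mult.commute flip: right_diff_distrib)
  then have "\<bar>partial a (partial b f) p - partial b (partial a f) p\<bar> \<le> 6 * e"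
    using h(1) by simp
  then show False using e by (simp add: e_def)
qed

subsection \<open>Uniqueness for linear differential systems\<close>

text \<open>On a small closed ball let \<open>m\<close>, the sum of the
  \<open>\<bar>u j\<bar>\<close>, attain its maximum at \<open>q\<close>. The system bounds the
  derivatives by a multiple of \<open>m q\<close>, so integrating from the zero at \<open>p0\<close>
  bounds \<open>m q\<close> by half of itself. The convex ball replaces paths and integral
  inequalities by one mean value estimate.\<close>

lemma linear_system_zero:
  fixes u :: "'i::finite \<Rightarrow> real^'n::finite \<Rightarrow> real"
  assumes S: "open S" "p0 \<in> S"
    and u: "\<And>i p. p \<in> S \<Longrightarrow> u i differentiable (at p)"
    and M: "\<And>a i j. continuous_on S (M a i j)"
    and eq: "\<And>a i p. p \<in> S \<Longrightarrow> partial a (u i) p = (\<Sum>j\<in>UNIV. M a i j p * u j p)"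
    and zero: "\<And>i. u i p0 = 0"
  shows "\<exists>r>0. ball p0 r \<subseteq> S \<and> (\<forall>p\<in>ball p0 r. \<forall>i. u i p = 0)"
proof -
  obtain r0 where r0: "r0 > 0" "cball p0 r0 \<subseteq> S"
    using S open_contains_cball by blast
  define K where "K p = (\<Sum>a\<in>UNIV. \<Sum>i\<in>UNIV. \<Sum>j\<in>UNIV. \<bar>M a i j p\<bar>)" for p
  have "continuous_on (cball p0 r0) K"
    unfolding K_def using M r0(2) continuous_on_subset by (intro continuous_intros) blast
  then have "bounded (K ` cball p0 r0)"
    using compact_continuous_image compact_cball compact_imp_bounded by blast
  then obtain B where B: "B > 0" "\<And>p. p \<in> cball p0 r0 \<Longrightarrow> \<bar>K p\<bar> \<le> B"
    unfolding bounded_pos by (auto simp: image_iff)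
  \<comment> \<open>\<open>N * m q\<close> will bound the operator norm of each derivative; the
    factor \<open>CARD('n)\<close> comes from bounding each coordinate of a vector by its
    norm.\<close>
  define N where "N = real CARD('n) * B"
  have N: "N > 0" using B by (simp add: N_def)
  define I where "I = real CARD('i)"
  have I: "I > 0" by (simp add: I_def)
  \<comment> \<open>Summing the estimate over the components of \<open>u\<close> yields the factor
    \<open>I * N * r\<close>, made at most 1/2 here.\<close>
  define r where "r = min r0 (1 / (2 * I * N))"
  have r: "r > 0" "r \<le> r0" "I * N * r \<le> 1/2"
  proof -
    show "r > 0" "r \<le> r0" using r0 I N by (auto simp: r_def)
    have "I * N * r \<le> I * N * (1 / (2 * I * N))" using I N by (intro mult_left_mono) (auto simp: r_def)
    then show "I * N * r \<le> 1/2" using I N by (simp add: field_simps)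
  qed
  have sub: "cball p0 r \<subseteq> cball p0 r0" "cball p0 r \<subseteq> S" using r r0 by auto
  define m where "m p = (\<Sum>j\<in>UNIV. \<bar>u j p\<bar>)" for p
  have "continuous_on S (u i)" for i
    using u by (simp add: continuous_at_imp_continuous_on differentiable_imp_continuous_within)
  then have "continuous_on (cball p0 r) m"
    unfolding m_def using sub(2) continuous_on_subset by (intro continuous_intros) blast
  moreover have "cball p0 r \<noteq> {}" using r by auto
  ultimately obtain q where q: "q \<in> cball p0 r" "\<And>p. p \<in> cball p0 r \<Longrightarrow> m p \<le> m q"
    using continuous_attains_sup[OF compact_cball] by blast
  have m0: "0 \<le> m p" for p by (simp add: m_def sum_nonneg)
  have ubound: "\<bar>u i p\<bar> \<le> N * m q * r" if p: "p \<in> cball p0 r" for i p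
  proof -
    have "norm (u i p - u i p0) \<le> (N * m q) * norm (p - p0)"
    proof (rule differentiable_bound[of "cball p0 r" "u i" "\<lambda>x v. \<Sum>a\<in>UNIV. v $ a * partial a (u i) x"])
      fix x assume x: "x \<in> cball p0 r"
      show "((u i) has_derivative (\<lambda>v. \<Sum>a\<in>UNIV. v $ a * partial a (u i) x)) (at x within cball p0 r)"
        using x sub u has_derivative_partial has_derivative_at_withinI by blast
      have pb: "\<bar>partial a (u i) x\<bar> \<le> B * m q" for a
      proof -
        have "\<bar>M a i j x\<bar> \<le> K x" for j
        proof -
          have "\<bar>M a i j x\<bar> \<le> (\<Sum>j\<in>UNIV. \<bar>M a i j x\<bar>)" by (intro member_le_sum) auto
          also have "\<dots> \<le> (\<Sum>i\<in>UNIV. \<Sum>j\<in>UNIV. \<bar>M a i j x\<bar>)"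
            by (rule member_le_sum[of i UNIV "\<lambda>i. \<Sum>j\<in>UNIV. \<bar>M a i j x\<bar>"]) (auto intro: sum_nonneg)
          also have "\<dots> \<le> K x" unfolding K_def
            by (rule member_le_sum[of a UNIV "\<lambda>a. \<Sum>i\<in>UNIV. \<Sum>j\<in>UNIV. \<bar>M a i j x\<bar>"]) (auto intro: sum_nonneg)
          finally show ?thesis .
        qed
        then have Mb: "\<bar>M a i j x\<bar> \<le> B" for j
          using B(2)[of x] x sub(1) by (meson abs_ge_self order_trans subsetD)
        have "\<bar>partial a (u i) x\<bar> \<le> (\<Sum>j\<in>UNIV. \<bar>M a i j x * u j x\<bar>)"
          using eq[of x] x sub by (auto intro: sum_abs)
        also have "\<dots> \<le> (\<Sum>j\<in>UNIV. B * \<bar>u j x\<bar>)"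
          using Mb by (intro sum_mono) (auto simp: abs_mult intro: mult_right_mono)
        also have "\<dots> = B * m x" by (simp add: m_def sum_distrib_left)
        also have "\<dots> \<le> B * m q" using q(2)[OF x] B by simp
        finally show ?thesis .
      qed
      show "onorm (\<lambda>v. \<Sum>a\<in>UNIV. v $ a * partial a (u i) x) \<le> N * m q"
      proof (rule onorm_le)
        fix v :: "real^'n"
        have "norm (\<Sum>a\<in>UNIV. v $ a * partial a (u i) x) \<le> (\<Sum>a\<in>(UNIV::'n set). norm v * (B * m q))"
          by (rule sum_norm_le)
            (use pb component_le_norm_cart[of v] in \<open>auto simp: abs_mult intro!: mult_mono\<close>)
        then show "norm (\<Sum>a\<in>UNIV. v $ a * partial a (u i) x) \<le> N * m q * norm v"
          by (simp add: N_def algebra_simps)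
      qed
    qed (use p r in auto)
    also have "\<dots> \<le> (N * m q) * r"
      using p N m0 by (intro mult_left_mono) (auto simp: dist_norm norm_minus_commute)
    finally show ?thesis using zero by simp
  qed
  have "m q \<le> (\<Sum>j\<in>(UNIV::'i set). N * m q * r)"
    unfolding m_def[of q] using ubound[OF q(1)] by (intro sum_mono) (auto simp: m_def)
  also have "\<dots> = (I * N * r) * m q" by (simp add: I_def algebra_simps)
  also have "\<dots> \<le> 1/2 * m q" using r(3) m0 by (intro mult_right_mono) auto
  finally have "m q = 0" using m0[of q] by simp
  then have "u i p = 0" if "p \<in> cball p0 r" for i p using ubound[OF that, of i] by simp
  then show ?thesis using r sub by (intro exI[of _ r]) auto
qed

subsection \<open>Coordinate derivatives\<close>

text \<open>The region may be smaller than the chart domain because a density representing a tractor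
  is smooth only near the point.\<close>

locale chart_region =
  fixes \<kappa> :: "('a, 'n::finite) chart" and U :: "'a set"
  assumes inj: "inj_on (snd \<kappa>) (fst \<kappa>)"
    and sub: "U \<subseteq> fst \<kappa>"
    and op: "open (snd \<kappa> ` U)"
begin

lemma coord_rep_at: "x \<in> U \<Longrightarrow> coord_rep \<kappa> f (snd \<kappa> x) = f x"
  using inj sub by (auto simp: coord_rep_def inv_into_f_f)

lemma coord_rep_eq: "(\<And>x. x \<in> U \<Longrightarrow> f x = h x) \<Longrightarrow> p \<in> snd \<kappa> ` U \<Longrightarrow> coord_rep \<kappa> f p = coord_rep \<kappa> h p"
  by (auto simp: coord_rep_at)

lemma smooth_in_iff: "smooth_in \<kappa> U f \<longleftrightarrow> smooth_on (snd \<kappa> ` U) (coord_rep \<kappa> f)"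
  using sub by (simp add: smooth_in_def Int_absorb1)

lemma smooth_in_generated: "smooth_in \<kappa> U f \<longleftrightarrow> generated (snd \<kappa> ` U) (coord_rep \<kappa> f)"
  unfolding smooth_in_iff using generated.base generated_smooth op by blast

lemma smooth_const [simp]: "smooth_in \<kappa> U (\<lambda>x. c)"
  using generated.const unfolding smooth_in_generated by (simp add: coord_rep_def o_def)

lemma smooth_add: "smooth_in \<kappa> U f \<Longrightarrow> smooth_in \<kappa> U h \<Longrightarrow> smooth_in \<kappa> U (\<lambda>x. f x + h x)"
  unfolding smooth_in_generated by (drule (1) generated.add) (simp add: coord_rep_def o_def)

lemma smooth_mult: "smooth_in \<kappa> U f \<Longrightarrow> smooth_in \<kappa> U h \<Longrightarrow> smooth_in \<kappa> U (\<lambda>x. f x * h x)"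
  unfolding smooth_in_generated by (drule (1) generated.mult) (simp add: coord_rep_def o_def)

lemma smooth_cong: "smooth_in \<kappa> U f \<Longrightarrow> (\<And>x. x \<in> U \<Longrightarrow> f x = h x) \<Longrightarrow> smooth_in \<kappa> U h"
  unfolding smooth_in_generated using generated.cong coord_rep_eq by blast

lemma smooth_inverse:
  assumes "smooth_in \<kappa> U f" "\<And>x. x \<in> U \<Longrightarrow> f x \<noteq> 0"
  shows "smooth_in \<kappa> U (\<lambda>x. inverse (f x))"
proof -
  have "generated (snd \<kappa> ` U) (\<lambda>p. inverse (coord_rep \<kappa> f p))"
    using assms unfolding smooth_in_generated by (intro generated.inverse) (auto simp: coord_rep_at)
  then show ?thesis unfolding smooth_in_generated by (simp add: coord_rep_def o_def)
qed

lemma smooth_abs: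
  assumes "smooth_in \<kappa> U f" "\<And>x. x \<in> U \<Longrightarrow> f x \<noteq> 0"
  shows "smooth_in \<kappa> U (\<lambda>x. \<bar>f x\<bar>)"
proof -
  have "generated (snd \<kappa> ` U) (\<lambda>p. \<bar>coord_rep \<kappa> f p\<bar>)"
    using assms unfolding smooth_in_generated by (intro generated.abs) (auto simp: coord_rep_at)
  then show ?thesis unfolding smooth_in_generated by (simp add: coord_rep_def o_def)
qed

lemma smooth_minus: "smooth_in \<kappa> U f \<Longrightarrow> smooth_in \<kappa> U (\<lambda>x. - f x)"
  using smooth_mult[OF smooth_const[of "-1"], of f] by simp

lemma smooth_diff: "smooth_in \<kappa> U f \<Longrightarrow> smooth_in \<kappa> U h \<Longrightarrow> smooth_in \<kappa> U (\<lambda>x. f x - h x)"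
  using smooth_add[OF _ smooth_minus, of f h] by simp

lemma smooth_sum:
  assumes "\<And>i. i \<in> I \<Longrightarrow> smooth_in \<kappa> U (f i)"
  shows "smooth_in \<kappa> U (\<lambda>x. \<Sum>i\<in>I. f i x)"
  using assms by (induction I rule: infinite_finite_induct) (auto intro: smooth_add)

lemma smooth_prod:
  assumes "\<And>i. i \<in> I \<Longrightarrow> smooth_in \<kappa> U (f i)"
  shows "smooth_in \<kappa> U (\<lambda>x. \<Prod>i\<in>I. f i x)"
  using assms by (induction I rule: infinite_finite_induct) (auto intro: smooth_mult)

lemma coord_rep_pd:
  assumes "p \<in> snd \<kappa> ` U"
  shows "coord_rep \<kappa> (pd \<kappa> a f) p = partial a (coord_rep \<kappa> f) p"
  using assms by (auto simp: coord_rep_at pd_def)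

lemma smooth_pd: "smooth_in \<kappa> U f \<Longrightarrow> smooth_in \<kappa> U (pd \<kappa> a f)"
  unfolding smooth_in_generated
  by (rule generated.cong[OF generated_partial[OF op, THEN conjunct2, rule_format, of "coord_rep \<kappa> f" a]])
    (auto simp: coord_rep_at pd_def)

lemmas smooth_intros = smooth_const smooth_add smooth_mult smooth_minus smooth_diff smooth_sum smooth_pd

lemma smooth_differentiable:
  "smooth_in \<kappa> U f \<Longrightarrow> x \<in> U \<Longrightarrow> coord_rep \<kappa> f differentiable (at (snd \<kappa> x))"
  using smooth_on_differentiable unfolding smooth_in_iff by blast

lemma pd_const [simp]: "pd \<kappa> a (\<lambda>x. c) x = 0"
  by (simp add: pd_def coord_rep_def o_def)

lemma pd_add:
  assumes "smooth_in \<kappa> U f" "smooth_in \<kappa> U h" "x \<in> U"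
  shows "pd \<kappa> a (\<lambda>x. f x + h x) x = pd \<kappa> a f x + pd \<kappa> a h x"
  using partial_add[OF smooth_differentiable smooth_differentiable, OF assms(1,3,2,3), of a]
  by (simp add: pd_def) (simp add: coord_rep_def o_def)

lemma pd_mult:
  assumes "smooth_in \<kappa> U f" "smooth_in \<kappa> U h" "x \<in> U"
  shows "pd \<kappa> a (\<lambda>x. f x * h x) x = pd \<kappa> a f x * h x + f x * pd \<kappa> a h x"
  using partial_mult[OF smooth_differentiable smooth_differentiable, OF assms(1,3,2,3), of a] assms(3)
  by (simp add: pd_def coord_rep_at) (simp add: coord_rep_def o_def)

lemma pd_minus:
  assumes "smooth_in \<kappa> U f" "x \<in> U"
  shows "pd \<kappa> a (\<lambda>x. - f x) x = - pd \<kappa> a f x"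
  using pd_mult[OF smooth_const[of "-1"] assms] by simp

lemma pd_diff:
  assumes "smooth_in \<kappa> U f" "smooth_in \<kappa> U h" "x \<in> U"
  shows "pd \<kappa> a (\<lambda>x. f x - h x) x = pd \<kappa> a f x - pd \<kappa> a h x"
  using pd_add[OF assms(1) smooth_minus[OF assms(2)] assms(3)] pd_minus[OF assms(2,3)] by simp

lemma pd_sum:
  assumes "\<And>i. i \<in> I \<Longrightarrow> smooth_in \<kappa> U (f i)" "x \<in> U"
  shows "pd \<kappa> a (\<lambda>x. \<Sum>i\<in>I. f i x) x = (\<Sum>i\<in>I. pd \<kappa> a (f i) x)"
  using assms(1)
proof (induction I rule: infinite_finite_induct)
  case (insert i I)
  then have "pd \<kappa> a (\<lambda>x. f i x + (\<Sum>i\<in>I. f i x)) x = pd \<kappa> a (f i) x + pd \<kappa> a (\<lambda>x. \<Sum>i\<in>I. f i x) x"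
    using assms(2) by (intro pd_add smooth_sum) auto
  then show ?case using insert by simp
qed auto

lemma pd_cong_region:
  assumes "\<And>y. y \<in> U \<Longrightarrow> f y = h y" "x \<in> U"
  shows "pd \<kappa> a f x = pd \<kappa> a h x"
  unfolding pd_def using partial_transform_open[OF op] assms coord_rep_eq by blast

lemma pd_commute:
  assumes "smooth_in \<kappa> U f" "x \<in> U"
  shows "pd \<kappa> a (pd \<kappa> b f) x = pd \<kappa> b (pd \<kappa> a f) x"
proof -
  have "pd \<kappa> a (pd \<kappa> b f) x = partial a (partial b (coord_rep \<kappa> f)) (snd \<kappa> x)" for a b
    unfolding pd_def[of \<kappa> a]
    by (rule partial_transform_open[OF op]) (use assms(2) coord_rep_pd in auto)
  then show ?thesis
    using partial_commute[OF op _ assms(1)[unfolded smooth_in_iff]] assms(2) by simp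
qed

lemma smooth_continuous: "smooth_in \<kappa> U f \<Longrightarrow> continuous_on (snd \<kappa> ` U) (coord_rep \<kappa> f)"
  unfolding smooth_in_iff
  by (simp add: continuous_at_imp_continuous_on differentiable_imp_continuous_within smooth_on_differentiable)

lemma linear_system_zero_region:
  fixes u :: "'i::finite \<Rightarrow> 'a \<Rightarrow> real"
  assumes "x \<in> U" "\<And>i. smooth_in \<kappa> U (u i)" "\<And>a i j. smooth_in \<kappa> U (M a i j)"
    and eq: "\<And>a i y. y \<in> U \<Longrightarrow> pd \<kappa> a (u i) y = (\<Sum>j\<in>UNIV. M a i j y * u j y)"
    and zero: "\<And>i. u i x = 0"
  shows "\<exists>V. open V \<and> snd \<kappa> x \<in> V \<and> (\<forall>y\<in>U. snd \<kappa> y \<in> V \<longrightarrow> (\<forall>i. u i y = 0))"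
proof -
  have "\<exists>r>0. ball (snd \<kappa> x) r \<subseteq> snd \<kappa> ` U \<and> (\<forall>p\<in>ball (snd \<kappa> x) r. \<forall>i. coord_rep \<kappa> (u i) p = 0)"
  proof (rule linear_system_zero[where M = "\<lambda>a i j. coord_rep \<kappa> (M a i j)"])
    fix a i p assume "p \<in> snd \<kappa> ` U"
    then obtain y where y: "y \<in> U" "p = snd \<kappa> y" by blast
    then show "partial a (coord_rep \<kappa> (u i)) p = (\<Sum>j\<in>UNIV. coord_rep \<kappa> (M a i j) p * coord_rep \<kappa> (u j) p)"
      using eq[of y a i] by (simp add: coord_rep_at pd_def)
  qed (use assms op smooth_differentiable smooth_continuous in \<open>auto simp: coord_rep_at\<close>)
  then obtain r where r: "r > 0" "\<forall>p\<in>ball (snd \<kappa> x) r. \<forall>i. coord_rep \<kappa> (u i) p = 0" by blast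
  have "u i y = 0" if "y \<in> U" "snd \<kappa> y \<in> ball (snd \<kappa> x) r" for y i
    using r(2) that coord_rep_at[of y "u i"] by auto
  then show ?thesis
    using r(1) by (intro exI[of _ "ball (snd \<kappa> x) r"]) auto
qed

end

section \<open>Curvature\<close>

lemma matrix_inv_inverse:
  fixes h :: "real^'n::finite^'n"
  assumes "invertible h"
  shows "matrix_inv h ** h = mat 1" "h ** matrix_inv h = mat 1"
  using assms someI_ex[of "\<lambda>B. h ** B = mat 1 \<and> B ** h = mat 1"]
  unfolding invertible_def matrix_inv_def by blast+

text \<open>Entries of the inverse become quotients of polynomials in the entries of
  \<open>h\<close>, which is how the inverse metric is seen to be smooth.\<close>

lemma matrix_inv_cramer:
  fixes h :: "real^'n::finite^'n"
  assumes "invertible h"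
  shows "matrix_inv h $ i $ j = det (\<chi> r c. if c = i then axis j 1 $ r else h $ r $ c) / det h"
proof -
  have "det h \<noteq> 0" using assms invertible_det_nz by blast
  moreover have "h *v column j (matrix_inv h) = axis j 1"
    using matrix_inv_inverse(2)[OF assms]
    by (simp add: vec_eq_iff matrix_vector_mult_def column_def matrix_matrix_mult_def mat_def axis_def)
  ultimately have "column j (matrix_inv h) = (\<chi> k. det (\<chi> r c. if c = k then axis j 1 $ r else h $ r $ c) / det h)"
    using cramer by blast
  from this[THEN arg_cong, of "\<lambda>v. v $ i"] show ?thesis by (simp add: column_def)
qed

locale metric_chart = chart_region \<kappa> "fst \<kappa>" for \<kappa> :: "('a, 'n::finite) chart" +
  fixes g :: "('a, 'n) metric"
  assumes smooth_g: "\<And>a b. smooth_in \<kappa> (fst \<kappa>) (\<lambda>x. g \<kappa> x $ a $ b)"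
    and transpose_g: "\<And>x. x \<in> fst \<kappa> \<Longrightarrow> transpose (g \<kappa> x) = g \<kappa> x"
    and invertible_g: "\<And>x. x \<in> fst \<kappa> \<Longrightarrow> invertible (g \<kappa> x)"
begin

abbreviation "smooth f \<equiv> smooth_in \<kappa> (fst \<kappa>) f"
abbreviation "\<Gamma> \<equiv> christoffel g \<kappa>"

lemma g_sym: "x \<in> fst \<kappa> \<Longrightarrow> g \<kappa> x $ a $ b = g \<kappa> x $ b $ a"
  by (metis transpose_g transpose_def vec_lambda_beta)

section \<open>The inverse metric and the Christoffel symbols\<close>

lemma smooth_ginv: "smooth (\<lambda>x. ginv g \<kappa> x $ a $ b)"
proof -
  have det: "smooth (\<lambda>x. det (M x))" if "\<And>i j. smooth (\<lambda>x. M x $ i $ j)" for M :: "'a \<Rightarrow> real^'n^'n"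
    unfolding det_def by (intro smooth_intros smooth_prod that)
  have nz: "det (g \<kappa> x) \<noteq> 0" if "x \<in> fst \<kappa>" for x
    using invertible_g[OF that] invertible_det_nz by blast
  have "smooth (\<lambda>x. if c = a then axis b 1 $ r else g \<kappa> x $ r $ c)" for r c
    using smooth_g by (cases "c = a") auto
  then have "smooth (\<lambda>x. det (\<chi> r c. if c = a then axis b 1 $ r else g \<kappa> x $ r $ c) * inverse (det (g \<kappa> x)))"
    using nz by (intro smooth_mult smooth_inverse det smooth_g) simp_all
  then show ?thesis
    by (rule smooth_cong) (simp add: ginv_def matrix_inv_cramer[OF invertible_g] divide_inverse)
qed

lemma ginv_g: "x \<in> fst \<kappa> \<Longrightarrow> (\<Sum>c\<in>UNIV. ginv g \<kappa> x $ a $ c * g \<kappa> x $ c $ b) = (if a = b then 1 else 0)"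
  using matrix_inv_inverse(1)[OF invertible_g]
  by (simp add: vec_eq_iff matrix_matrix_mult_def mat_def ginv_def)

lemma g_ginv: "x \<in> fst \<kappa> \<Longrightarrow> (\<Sum>c\<in>UNIV. g \<kappa> x $ a $ c * ginv g \<kappa> x $ c $ b) = (if a = b then 1 else 0)"
  using matrix_inv_inverse(2)[OF invertible_g]
  by (simp add: vec_eq_iff matrix_matrix_mult_def mat_def ginv_def)

lemma ginv_sym:
  assumes "x \<in> fst \<kappa>"
  shows "ginv g \<kappa> x $ a $ b = ginv g \<kappa> x $ b $ a"
proof -
  let ?h = "ginv g \<kappa> x"
  have "transpose ?h ** g \<kappa> x = mat 1"
    using matrix_inv_inverse(2)[OF invertible_g[OF assms]] transpose_g[OF assms]
    by (metis ginv_def matrix_transpose_mul transpose_mat)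
  then have "transpose ?h = ?h"
    using matrix_inv_inverse(2)[OF invertible_g[OF assms]]
    by (metis ginv_def matrix_mul_assoc matrix_mul_lid matrix_mul_rid)
  from this[THEN arg_cong, of "\<lambda>m. m $ b $ a"] show ?thesis by (simp add: transpose_def)
qed

lemma smooth_christoffel: "smooth (\<Gamma> c a b)"
  unfolding christoffel_def[abs_def] by (intro smooth_intros smooth_ginv smooth_g)

text \<open>Christoffel symbols of the first kind, lowered index first. They are linear in the first
  derivatives of the metric with constant coefficients, so differentiating them never meets the
  inverse metric.\<close>

definition christoffel_low :: "'n \<Rightarrow> 'n \<Rightarrow> 'n \<Rightarrow> 'a \<Rightarrow> real" where
  "christoffel_low c a b x = (1/2) * (pd \<kappa> a (\<lambda>y. g \<kappa> y $ b $ c) x + pd \<kappa> b (\<lambda>y. g \<kappa> y $ a $ c) x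
         - pd \<kappa> c (\<lambda>y. g \<kappa> y $ a $ b) x)"

lemma pd_g_sym: "x \<in> fst \<kappa> \<Longrightarrow> pd \<kappa> d (\<lambda>y. g \<kappa> y $ a $ b) x = pd \<kappa> d (\<lambda>y. g \<kappa> y $ b $ a) x"
  by (intro pd_cong_region g_sym)

lemma christoffel_sym: "x \<in> fst \<kappa> \<Longrightarrow> \<Gamma> c a b x = \<Gamma> c b a x"
  using pd_g_sym by (simp add: christoffel_def add.commute)

lemma christoffel_low_sym: "x \<in> fst \<kappa> \<Longrightarrow> christoffel_low c a b x = christoffel_low c b a x"
  using pd_g_sym[of x c a b] by (simp add: christoffel_low_def add.commute)

lemma christoffel_lower:
  assumes "x \<in> fst \<kappa>"
  shows "(\<Sum>e\<in>UNIV. g \<kappa> x $ c $ e * \<Gamma> e a b x) = christoffel_low c a b x"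
proof -
  have "(\<Sum>e\<in>UNIV. g \<kappa> x $ c $ e * \<Gamma> e a b x) =
      (1/2) * (\<Sum>e\<in>UNIV. g \<kappa> x $ c $ e * (\<Sum>d\<in>UNIV. matrix_inv (g \<kappa> x) $ e $ d *
        (pd \<kappa> a (\<lambda>y. g \<kappa> y $ b $ d) x + pd \<kappa> b (\<lambda>y. g \<kappa> y $ a $ d) x
         - pd \<kappa> d (\<lambda>y. g \<kappa> y $ a $ b) x)))"
    unfolding christoffel_def ginv_def
    by (subst sum_distrib_left[of "1/2"], intro sum.cong refl) (simp only: mult.left_commute)
  then show ?thesis
    by (simp only: sum_matrix_inv[OF invertible_g[OF assms]] christoffel_low_def)
qed

lemma pd_g: "x \<in> fst \<kappa> \<Longrightarrow> pd \<kappa> a (\<lambda>y. g \<kappa> y $ b $ c) x = christoffel_low b a c x + christoffel_low c a b x"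
  unfolding christoffel_low_def using pd_g_sym[of x a b c] pd_g_sym[of x b a c] pd_g_sym[of x c a b]
  by (simp add: field_simps)

section \<open>The Riemann tensor and its symmetries\<close>

lemma curv_up_christoffel:
  "curv_up g \<kappa> a b c d x = pd \<kappa> a (\<Gamma> c b d) x - pd \<kappa> b (\<Gamma> c a d) x
     + (\<Sum>e\<in>UNIV. \<Gamma> c a e x * \<Gamma> e b d x) - (\<Sum>e\<in>UNIV. \<Gamma> c b e x * \<Gamma> e a d x)"
  if "x \<in> fst \<kappa>"
proof -
  \<comment> \<open>The field has constant components, so its covariant derivative is a Christoffel
    symbol. In the commutator the terms acting on the form index cancel by symmetry of \<Gamma> in
    its lower indices.\<close>
  have "coord_field d e = (\<lambda>x::'a. if e = d then 1 else 0)" for e :: 'n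
    by (intro ext) (simp add: coord_field_def)
  then have "cov_vec g \<kappa> b (coord_field d) = (\<lambda>c. \<Gamma> c b d)" for b
    by (intro ext) (simp add: cov_vec_def if_distrib cong: if_cong)
  then show ?thesis
    using christoffel_sym[OF that] by (simp add: curv_up_def cov_mixed_def)
qed

lemma smooth_curv_up: "smooth (curv_up g \<kappa> a b c d)"
  by (rule smooth_cong[of "\<lambda>x. pd \<kappa> a (\<Gamma> c b d) x - pd \<kappa> b (\<Gamma> c a d) x
     + (\<Sum>e\<in>UNIV. \<Gamma> c a e x * \<Gamma> e b d x) - (\<Sum>e\<in>UNIV. \<Gamma> c b e x * \<Gamma> e a d x)"])
    (intro smooth_intros smooth_christoffel, simp add: curv_up_christoffel)

lemma smooth_curv: "smooth (curv g \<kappa> a b c d)"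
  unfolding curv_def[abs_def] by (intro smooth_intros smooth_curv_up smooth_g)

text \<open>The metric pairing of the vectors with components \<open>\<Gamma> e a c\<close> and
  \<open>\<Gamma> e b d\<close>, one of them already lowered; this is why the pairs
  \<open>a c\<close> and \<open>b d\<close> can be exchanged.\<close>

definition christoffel_square :: "'n \<Rightarrow> 'n \<Rightarrow> 'n \<Rightarrow> 'n \<Rightarrow> 'a \<Rightarrow> real" where
  "christoffel_square a c b d x = (\<Sum>e\<in>UNIV. christoffel_low e a c x * \<Gamma> e b d x)"

lemma christoffel_square_sym:
  assumes "x \<in> fst \<kappa>"
  shows "christoffel_square a c b d x = christoffel_square c a b d x"
    "christoffel_square a c b d x = christoffel_square a c d b x"
    "christoffel_square a c b d x = christoffel_square b d a c x"
proof -
  show "christoffel_square a c b d x = christoffel_square c a b d x"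
    "christoffel_square a c b d x = christoffel_square a c d b x"
    using christoffel_low_sym[OF assms, of _ a c] christoffel_sym[OF assms, of _ b d]
    by (simp_all add: christoffel_square_def)
  have "christoffel_square a c b d x = (\<Sum>e\<in>UNIV. \<Sum>f\<in>UNIV. g \<kappa> x $ e $ f * \<Gamma> f a c x * \<Gamma> e b d x)"
    by (simp add: christoffel_square_def sum_distrib_right flip: christoffel_lower[OF assms])
  also have "\<dots> = (\<Sum>f\<in>UNIV. \<Sum>e\<in>UNIV. g \<kappa> x $ f $ e * \<Gamma> e b d x * \<Gamma> f a c x)"
    by (subst sum.swap, intro sum.cong refl) (simp add: g_sym[OF assms])
  also have "\<dots> = christoffel_square b d a c x"
    by (simp add: christoffel_square_def sum_distrib_right flip: christoffel_lower[OF assms])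
  finally show "christoffel_square a c b d x = christoffel_square b d a c x" .
qed

definition hess_g :: "'n \<Rightarrow> 'n \<Rightarrow> 'n \<Rightarrow> 'n \<Rightarrow> 'a \<Rightarrow> real" where
  "hess_g a b c d x = pd \<kappa> a (pd \<kappa> b (\<lambda>y. g \<kappa> y $ c $ d)) x"

lemma hess_g_sym:
  assumes "x \<in> fst \<kappa>"
  shows "hess_g a b c d x = hess_g b a c d x" "hess_g a b c d x = hess_g a b d c x"
proof -
  show "hess_g a b c d x = hess_g b a c d x"
    unfolding hess_g_def using pd_commute[OF smooth_g assms] .
  show "hess_g a b c d x = hess_g a b d c x"
    unfolding hess_g_def by (rule pd_cong_region[OF _ assms]) (rule pd_g_sym)
qed

lemma pd_christoffel_low:
  assumes "x \<in> fst \<kappa>"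
  shows "pd \<kappa> a (christoffel_low c b d) x = (1/2) * (hess_g a b d c x + hess_g a d b c x - hess_g a c b d x)"
  unfolding christoffel_low_def[abs_def] hess_g_def
  by (simp only: pd_mult[OF smooth_const smooth_diff[OF smooth_add] assms] smooth_pd smooth_g
      pd_diff[OF smooth_add _ assms] pd_add[OF _ _ assms] pd_const mult_zero_left add_0)

text \<open>Lowering does not commute with \<open>pd\<close>: the product rule differentiates the
  metric, and \<open>pd_g\<close> splits that derivative in two. One part cancels the quadratic term
  of the curvature, the other becomes a \<open>christoffel_square\<close>.\<close>

lemma lower_pd_christoffel:
  assumes "x \<in> fst \<kappa>"
  shows "(\<Sum>e\<in>UNIV. g \<kappa> x $ c $ e * pd \<kappa> a (\<Gamma> e b d) x) = pd \<kappa> a (christoffel_low c b d) x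
     - (\<Sum>e\<in>UNIV. christoffel_low c a e x * \<Gamma> e b d x) - christoffel_square a c b d x"
proof -
  have "pd \<kappa> a (christoffel_low c b d) x = pd \<kappa> a (\<lambda>y. \<Sum>e\<in>UNIV. g \<kappa> y $ c $ e * \<Gamma> e b d y) x"
    by (rule pd_cong_region[OF _ assms]) (simp add: christoffel_lower)
  also have "\<dots> = (\<Sum>e\<in>UNIV. pd \<kappa> a (\<lambda>y. g \<kappa> y $ c $ e) x * \<Gamma> e b d x + g \<kappa> x $ c $ e * pd \<kappa> a (\<Gamma> e b d) x)"
    by (subst pd_sum[OF smooth_mult[OF smooth_g smooth_christoffel] assms], intro sum.cong refl
        pd_mult smooth_g smooth_christoffel assms)
  finally show ?thesis
    by (simp add: pd_g[OF assms] christoffel_square_def sum.distrib algebra_simps)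
qed

text \<open>The classical coordinate formula for the lowered curvature. Every symmetry needed later
  can be read off from those of the Hessian and of the quadratic term, without a Bianchi
  identity.\<close>

lemma curv_hess:
  assumes "x \<in> fst \<kappa>"
  shows "curv g \<kappa> a b c d x = (1/2) * (hess_g a d b c x - hess_g a c b d x - hess_g b d a c x + hess_g b c a d x)
     - christoffel_square a c b d x + christoffel_square b c a d x"
proof -
  have quad: "(\<Sum>e\<in>UNIV. g \<kappa> x $ c $ e * (\<Sum>f\<in>UNIV. \<Gamma> e a f x * \<Gamma> f b d x)) =
      (\<Sum>f\<in>UNIV. christoffel_low c a f x * \<Gamma> f b d x)" for a b
  proof -
    have "(\<Sum>e\<in>UNIV. g \<kappa> x $ c $ e * (\<Sum>f\<in>UNIV. \<Gamma> e a f x * \<Gamma> f b d x)) =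
        (\<Sum>f\<in>UNIV. \<Sum>e\<in>UNIV. g \<kappa> x $ c $ e * \<Gamma> e a f x * \<Gamma> f b d x)"
      by (subst sum.swap) (simp add: sum_distrib_left mult.assoc)
    then show ?thesis by (simp add: christoffel_lower[OF assms] flip: sum_distrib_right)
  qed
  have "curv g \<kappa> a b c d x =
      (\<Sum>e\<in>UNIV. g \<kappa> x $ c $ e * pd \<kappa> a (\<Gamma> e b d) x) - (\<Sum>e\<in>UNIV. g \<kappa> x $ c $ e * pd \<kappa> b (\<Gamma> e a d) x)
      + (\<Sum>e\<in>UNIV. g \<kappa> x $ c $ e * (\<Sum>f\<in>UNIV. \<Gamma> e a f x * \<Gamma> f b d x))
      - (\<Sum>e\<in>UNIV. g \<kappa> x $ c $ e * (\<Sum>f\<in>UNIV. \<Gamma> e b f x * \<Gamma> f a d x))"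
    unfolding curv_def curv_up_christoffel[OF assms]
    by (simp only: right_diff_distrib distrib_left sum.distrib sum_subtractf)
  also have "\<dots> = pd \<kappa> a (christoffel_low c b d) x - christoffel_square a c b d x
      - (pd \<kappa> b (christoffel_low c a d) x - christoffel_square b c a d x)"
    unfolding quad lower_pd_christoffel[OF assms] by simp
  finally show ?thesis
    using hess_g_sym(1)[OF assms, of a b d c] by (simp add: pd_christoffel_low[OF assms] field_simps)
qed

lemma curv_antisym1: "x \<in> fst \<kappa> \<Longrightarrow> curv g \<kappa> b a c d x = - curv g \<kappa> a b c d x"
  by (simp add: curv_hess field_simps)

text \<open>Exchanging the pairs fixes the two negative Hessian terms, interchanges the two positive
  ones, and fixes each quadratic term.\<close>

lemma curv_pair:
  assumes "x \<in> fst \<kappa>"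
  shows "curv g \<kappa> c d a b x = curv g \<kappa> a b c d x"
proof -
  have h: "hess_g c b d a x = hess_g b c a d x" "hess_g c a d b x = hess_g a c b d x"
    "hess_g d b c a x = hess_g b d a c x" "hess_g d a c b x = hess_g a d b c x"
    using hess_g_sym[OF assms, of c b d a] hess_g_sym[OF assms, of c a d b] hess_g_sym[OF assms, of d b c a]
      hess_g_sym[OF assms, of d a c b] hess_g_sym(2)[OF assms, of b c d a] hess_g_sym(2)[OF assms, of a c d b]
      hess_g_sym(2)[OF assms, of b d c a] hess_g_sym(2)[OF assms, of a d c b] by linarith+
  have q: "christoffel_square c a d b x = christoffel_square a c b d x"
     "christoffel_square d a c b x = christoffel_square b c a d x"
    using christoffel_square_sym(1)[OF assms, of c a d b] christoffel_square_sym(2)[OF assms, of a c d b]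
      christoffel_square_sym(3)[OF assms, of d a c b] christoffel_square_sym(2)[OF assms, of c b d a]
      christoffel_square_sym(1)[OF assms, of c b a d] by linarith+
  show ?thesis unfolding curv_hess[OF assms] h q by simp
qed

lemma curv_antisym2: "x \<in> fst \<kappa> \<Longrightarrow> curv g \<kappa> a b d c x = - curv g \<kappa> a b c d x"
  using curv_pair[of x a b d c] curv_pair[of x a b c d] curv_antisym1[of x d c a b] by simp

end

subsection \<open>The Schouten tensor\<close>

context metric_chart
begin

definition ricci :: "'n \<Rightarrow> 'n \<Rightarrow> 'a \<Rightarrow> real" where
  "ricci b d x = (\<Sum>a\<in>UNIV. \<Sum>c\<in>UNIV. ginv g \<kappa> x $ a $ c * curv g \<kappa> a b c d x)"

definition scalar_curv :: "'a \<Rightarrow> real" where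
  "scalar_curv x = (\<Sum>b\<in>UNIV. \<Sum>d\<in>UNIV. ginv g \<kappa> x $ b $ d * ricci b d x)"

text \<open>Found by contracting the decomposition of the curvature twice.\<close>

definition schouten_ricci :: "'a \<Rightarrow> real^'n^'n" where
  "schouten_ricci x = (\<chi> b d. (ricci b d x - scalar_curv x / (2 * (real CARD('n) - 1)) * g \<kappa> x $ b $ d)
      / (real CARD('n) - 2))"

lemma contract_left:
  assumes "x \<in> fst \<kappa>"
  shows "(\<Sum>a\<in>UNIV. \<Sum>c\<in>UNIV. ginv g \<kappa> x $ a $ c * (g \<kappa> x $ c $ b * v a)) = v b"
proof -
  have "(\<Sum>a\<in>UNIV. \<Sum>c\<in>UNIV. ginv g \<kappa> x $ a $ c * (g \<kappa> x $ c $ b * v a)) =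
      (\<Sum>a\<in>UNIV. (\<Sum>c\<in>UNIV. ginv g \<kappa> x $ a $ c * g \<kappa> x $ c $ b) * v a)"
    by (simp add: sum_distrib_right mult.assoc)
  then show ?thesis by (simp add: ginv_g[OF assms] if_distrib[of "\<lambda>y. y * _"] cong: if_cong)
qed

lemma contract_right:
  assumes "x \<in> fst \<kappa>"
  shows "(\<Sum>a\<in>UNIV. \<Sum>c\<in>UNIV. ginv g \<kappa> x $ a $ c * (g \<kappa> x $ d $ a * v c)) = v d"
proof -
  have "(\<Sum>a\<in>UNIV. \<Sum>c\<in>UNIV. ginv g \<kappa> x $ a $ c * (g \<kappa> x $ d $ a * v c)) =
      (\<Sum>c\<in>UNIV. \<Sum>a\<in>UNIV. ginv g \<kappa> x $ c $ a * (g \<kappa> x $ a $ d * v c))"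
    by (subst sum.swap, intro sum.cong refl) (metis ginv_sym[OF assms] g_sym[OF assms])
  then show ?thesis using contract_left[OF assms] by simp
qed

lemma contract_g:
  assumes "x \<in> fst \<kappa>"
  shows "(\<Sum>a\<in>UNIV. \<Sum>c\<in>UNIV. ginv g \<kappa> x $ a $ c * g \<kappa> x $ c $ a) = real CARD('n)"
  using ginv_g[OF assms] by simp

text \<open>Valid for an arbitrary candidate \<open>P\<close>, so it serves both existence and
  uniqueness of the Schouten tensor. In the coefficient, \<open>CARD('n)\<close> is the trace of the
  metric and the two mixed contractions account for the 2.\<close>

lemma trace_weyl_of:
  assumes "x \<in> fst \<kappa>"
  shows "(\<Sum>a\<in>UNIV. \<Sum>c\<in>UNIV. ginv g \<kappa> x $ a $ c * weyl_of g \<kappa> x P a b c d) =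
    ricci b d x - (real CARD('n) - 2) * P $ b $ d
      - (\<Sum>a\<in>UNIV. \<Sum>c\<in>UNIV. ginv g \<kappa> x $ a $ c * P $ a $ c) * g \<kappa> x $ b $ d"
proof -
  let ?h = "ginv g \<kappa> x" and ?g = "g \<kappa> x"
  have "(\<Sum>a\<in>UNIV. \<Sum>c\<in>UNIV. ?h $ a $ c * weyl_of g \<kappa> x P a b c d) =
     (\<Sum>a\<in>UNIV. \<Sum>c\<in>UNIV. ?h $ a $ c * curv g \<kappa> a b c d x)
     - (\<Sum>a\<in>UNIV. \<Sum>c\<in>UNIV. ?h $ a $ c * ?g $ c $ a * P $ b $ d)
     + (\<Sum>a\<in>UNIV. \<Sum>c\<in>UNIV. ?h $ a $ c * (?g $ c $ b * P $ a $ d))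
     - (\<Sum>a\<in>UNIV. \<Sum>c\<in>UNIV. ?h $ a $ c * P $ a $ c * ?g $ d $ b)
     + (\<Sum>a\<in>UNIV. \<Sum>c\<in>UNIV. ?h $ a $ c * (?g $ d $ a * P $ b $ c))"
    unfolding sum_subtractf[symmetric] sum.distrib[symmetric]
    by (intro sum.cong refl) (simp add: weyl_of_def algebra_simps)
  also have "(\<Sum>a\<in>UNIV. \<Sum>c\<in>UNIV. ?h $ a $ c * ?g $ c $ a * P $ b $ d) = real CARD('n) * P $ b $ d"
    by (simp only: sum_distrib_right[symmetric] contract_g[OF assms])
  also have "(\<Sum>a\<in>UNIV. \<Sum>c\<in>UNIV. ?h $ a $ c * P $ a $ c * ?g $ d $ b) =
      (\<Sum>a\<in>UNIV. \<Sum>c\<in>UNIV. ?h $ a $ c * P $ a $ c) * ?g $ b $ d"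
    by (simp only: sum_distrib_right[symmetric] g_sym[OF assms, of d b])
  finally show ?thesis
    unfolding contract_left[OF assms] contract_right[OF assms] ricci_def by (simp add: left_diff_distrib)
qed

lemma ricci_sym:
  assumes "x \<in> fst \<kappa>"
  shows "ricci b d x = ricci d b x"
  unfolding ricci_def
  by (subst sum.swap, intro sum.cong refl) (simp add: ginv_sym[OF assms] curv_pair[OF assms, of _ b _ d])

lemma transpose_schouten_ricci: "x \<in> fst \<kappa> \<Longrightarrow> transpose (schouten_ricci x) = schouten_ricci x"
  using ricci_sym g_sym by (simp add: vec_eq_iff transpose_def schouten_ricci_def)

context
  assumes dim: "CARD('n) \<ge> 3"
begin

lemma trace_schouten_ricci:
  assumes "x \<in> fst \<kappa>"
  shows "(\<Sum>a\<in>UNIV. \<Sum>c\<in>UNIV. ginv g \<kappa> x $ a $ c * schouten_ricci x $ a $ c)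
    = scalar_curv x / (2 * (real CARD('n) - 1))"
proof -
  define n where "n = real CARD('n)"
  have n: "n \<ge> 3" using dim by (simp add: n_def)
  define K where "K = scalar_curv x / (2 * (n - 1))"
  have "(\<Sum>a\<in>UNIV. \<Sum>c\<in>UNIV. ginv g \<kappa> x $ a $ c * schouten_ricci x $ a $ c) =
      (\<Sum>a\<in>UNIV. \<Sum>c\<in>UNIV. (ginv g \<kappa> x $ a $ c * ricci a c x) * (1 / (n - 2))
        - (ginv g \<kappa> x $ a $ c * g \<kappa> x $ c $ a) * (K / (n - 2)))"
  proof (intro sum.cong refl)
    fix a c
    show "ginv g \<kappa> x $ a $ c * schouten_ricci x $ a $ c = (ginv g \<kappa> x $ a $ c * ricci a c x) * (1 / (n - 2))
        - (ginv g \<kappa> x $ a $ c * g \<kappa> x $ c $ a) * (K / (n - 2))"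
      unfolding schouten_ricci_def n_def[symmetric] K_def[symmetric] g_sym[OF assms, of c a]
      by (simp add: diff_divide_distrib right_diff_distrib mult_ac)
  qed
  also have "\<dots> = scalar_curv x * (1 / (n - 2)) - n * (K / (n - 2))"
    by (simp only: sum_subtractf sum_distrib_right[symmetric] contract_g[OF assms] scalar_curv_def n_def)
  \<comment> \<open>Dimension at least 3 permits cancelling n - 2, because 1 - n / (2 (n - 1)) = (n
    - 2) / (2 (n - 1)).\<close>
  also have "\<dots> = scalar_curv x / (2 * (n - 1))"
    using n unfolding K_def by (simp add: divide_simps) (simp add: algebra_simps)
  finally show ?thesis by (simp add: n_def)
qed

text \<open>For symmetric \<open>P\<close> the remainder inherits the curvature symmetries. Two of
  the six traces then contract an antisymmetric pair with a symmetric matrix, and the other four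
  agree up to sign with the one computed in \<open>trace_weyl_of\<close>.\<close>

lemma totally_trace_free_schouten_ricci:
  assumes "x \<in> fst \<kappa>"
  shows "totally_trace_free (ginv g \<kappa> x) (weyl_of g \<kappa> x (schouten_ricci x))"
proof -
  let ?h = "ginv g \<kappa> x" and ?W = "weyl_of g \<kappa> x (schouten_ricci x)"
  have P: "schouten_ricci x $ a $ b = schouten_ricci x $ b $ a" for a b
    using transpose_schouten_ricci[OF assms, THEN arg_cong, of "\<lambda>m. m $ b $ a"] by (simp add: transpose_def)
  have anti1: "?W b a c d = - ?W a b c d" for a b c d
    using curv_antisym1[OF assms, of a b c d] P g_sym[OF assms] by (simp add: weyl_of_def algebra_simps)
  have anti2: "?W a b d c = - ?W a b c d" for a b c d
    using curv_antisym2[OF assms, of a b c d] P g_sym[OF assms] by (simp add: weyl_of_def algebra_simps)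
  have pair: "?W c d a b = ?W a b c d" for a b c d
    using curv_pair[OF assms, of a b c d] P g_sym[OF assms] by (simp add: weyl_of_def algebra_simps)
  have n: "real CARD('n) - 2 > 0" using dim by simp
  have t2: "(\<Sum>a\<in>UNIV. \<Sum>b\<in>UNIV. ?h $ a $ b * ?W a c b d) = 0" for c d
    unfolding trace_weyl_of[OF assms] trace_schouten_ricci[OF assms]
    using n by (simp add: schouten_ricci_def)
  have t1: "(\<Sum>a\<in>UNIV. \<Sum>b\<in>UNIV. ?h $ a $ b * ?W a b c d) = 0" for c d
  proof -
    have "(\<Sum>a\<in>UNIV. \<Sum>b\<in>UNIV. ?h $ a $ b * ?W a b c d) = (\<Sum>a\<in>UNIV. \<Sum>b\<in>UNIV. ?h $ b $ a * ?W b a c d)"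
      by (rule sum.swap)
    also have "\<dots> = (\<Sum>a\<in>UNIV. \<Sum>b\<in>UNIV. - (?h $ a $ b * ?W a b c d))"
    proof (intro sum.cong refl)
      fix a b
      show "?h $ b $ a * ?W b a c d = - (?h $ a $ b * ?W a b c d)"
        using anti1[of b a c d] ginv_sym[OF assms, of b a] by simp
    qed
    also have "\<dots> = - (\<Sum>a\<in>UNIV. \<Sum>b\<in>UNIV. ?h $ a $ b * ?W a b c d)" by (simp add: sum_negf)
    finally show ?thesis by simp
  qed
  have "(\<Sum>a\<in>UNIV. \<Sum>b\<in>UNIV. ?h $ a $ b * ?W a c d b) = 0" for c d
    using t2[of c d] by (simp add: anti2[of _ c d] sum_negf)
  moreover have "(\<Sum>a\<in>UNIV. \<Sum>b\<in>UNIV. ?h $ a $ b * ?W c a b d) = 0" for c d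
    using t2[of c d] by (simp add: anti1[of c] sum_negf)
  moreover have "(\<Sum>a\<in>UNIV. \<Sum>b\<in>UNIV. ?h $ a $ b * ?W c a d b) = 0" for c d
    using t2[of c d] by (simp add: anti1[of c] anti2[of _ c d] sum_negf)
  moreover have "(\<Sum>a\<in>UNIV. \<Sum>b\<in>UNIV. ?h $ a $ b * ?W c d a b) = 0" for c d
    using t1[of c d] by (simp add: pair[of c d])
  ultimately show ?thesis
    using t1 t2 unfolding totally_trace_free_def by blast
qed

text \<open>Uniqueness needs a single trace condition: contracting it once more yields
  \<open>scalar_curv x = 2 * (n - 1) * J\<close>, so the trace of \<open>P\<close> is known and the
  condition can be solved for \<open>P\<close>.\<close>

lemma schouten_eq:
  assumes "x \<in> fst \<kappa>"
  shows "schouten g \<kappa> x = schouten_ricci x"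
  unfolding schouten_def
proof (rule the_equality)
  show "transpose (schouten_ricci x) = schouten_ricci x \<and>
      totally_trace_free (ginv g \<kappa> x) (weyl_of g \<kappa> x (schouten_ricci x))"
    using transpose_schouten_ricci totally_trace_free_schouten_ricci assms by blast
next
  fix P assume P: "transpose P = P \<and> totally_trace_free (ginv g \<kappa> x) (weyl_of g \<kappa> x P)"
  define n where "n = real CARD('n)"
  have n: "n \<ge> 3" using dim by (simp add: n_def)
  define J where "J = (\<Sum>a\<in>UNIV. \<Sum>c\<in>UNIV. ginv g \<kappa> x $ a $ c * P $ a $ c)"
  have eq: "ricci b d x = (n - 2) * P $ b $ d + J * g \<kappa> x $ b $ d" for b d
  proof -
    have "(\<Sum>a\<in>UNIV. \<Sum>c\<in>UNIV. ginv g \<kappa> x $ a $ c * weyl_of g \<kappa> x P a b c d) = 0"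
      using P unfolding totally_trace_free_def by blast
    then show ?thesis unfolding trace_weyl_of[OF assms] by (simp add: J_def n_def)
  qed
  have "scalar_curv x = (\<Sum>b\<in>UNIV. \<Sum>d\<in>UNIV. (n - 2) * (ginv g \<kappa> x $ b $ d * P $ b $ d)
      + J * (ginv g \<kappa> x $ b $ d * g \<kappa> x $ d $ b))"
    unfolding scalar_curv_def eq
    by (intro sum.cong refl) (simp add: g_sym[OF assms] algebra_simps)
  also have "\<dots> = (n - 2) * J + J * n"
    by (simp only: sum.distrib sum_distrib_left[symmetric] contract_g[OF assms] J_def n_def)
  finally have "scalar_curv x / (2 * (n - 1)) = J"
    using n by (simp add: field_simps)
  then have "P $ b $ d = (ricci b d x - scalar_curv x / (2 * (n - 1)) * g \<kappa> x $ b $ d) / (n - 2)" for b d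
    using eq[of b d] n by simp
  then show "P = schouten_ricci x"
    by (simp add: vec_eq_iff schouten_ricci_def n_def)
qed

lemma smooth_schouten: "smooth (\<lambda>x. schouten g \<kappa> x $ a $ b)"
proof -
  have "smooth (ricci a b)" for a b
    unfolding ricci_def[abs_def] by (intro smooth_intros smooth_ginv smooth_curv)
  moreover from this have "smooth scalar_curv"
    unfolding scalar_curv_def[abs_def] by (intro smooth_intros smooth_ginv)
  ultimately have "smooth (\<lambda>x. (ricci a b x - scalar_curv x * (1 / (2 * (real CARD('n) - 1))) * g \<kappa> x $ a $ b)
      * (1 / (real CARD('n) - 2)))"
    by (intro smooth_intros smooth_g)
  then show ?thesis
    by (rule smooth_cong) (simp add: schouten_eq schouten_ricci_def)
qed

lemma smooth_weyl: "smooth (weyl g \<kappa> a b c d)"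
  unfolding weyl_def[abs_def] weyl_of_def by (intro smooth_intros smooth_curv smooth_schouten smooth_g)

end

end

section \<open>Parallel tractors in a chart\<close>

text \<open>The parallel equations for plain component functions, detached from jets; the tractor
  field enters only through an interpretation of this locale for each metric and chart.\<close>

locale parallel_chart = metric_chart \<kappa> g for \<kappa> :: "('a, 'n::finite) chart" and g +
  fixes \<sigma> :: "'a \<Rightarrow> real" and \<mu> :: "'n \<Rightarrow> 'a \<Rightarrow> real" and \<rho> :: "'a \<Rightarrow> real"
  assumes dim: "CARD('n) \<ge> 3"
    and smooth_sigma: "smooth_in \<kappa> (fst \<kappa>) \<sigma>"
    and smooth_mu: "\<And>a. smooth_in \<kappa> (fst \<kappa>) (\<mu> a)"
    and smooth_rho: "smooth_in \<kappa> (fst \<kappa>) \<rho>"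
    and pd_sigma: "\<And>x a. x \<in> fst \<kappa> \<Longrightarrow> pd \<kappa> a \<sigma> x = \<mu> a x"
    and cov_mu: "\<And>x a b. x \<in> fst \<kappa> \<Longrightarrow>
      cov_form g \<kappa> a \<mu> b x + g \<kappa> x $ a $ b * \<rho> x + schouten g \<kappa> x $ a $ b * \<sigma> x = 0"
    and pd_rho: "\<And>x a. x \<in> fst \<kappa> \<Longrightarrow> pd \<kappa> a \<rho> x =
      (\<Sum>b\<in>UNIV. schouten g \<kappa> x $ a $ b * (\<Sum>c\<in>UNIV. ginv g \<kappa> x $ b $ c * \<mu> c x))"
begin

abbreviation "P a b x \<equiv> schouten g \<kappa> x $ a $ b"

definition mu_up :: "'n \<Rightarrow> 'a \<Rightarrow> real" where
  "mu_up d x = (\<Sum>e\<in>UNIV. ginv g \<kappa> x $ d $ e * \<mu> e x)"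

text \<open>The Cotton tensor \<open>\<nabla>\<^sub>a P\<^sub>b\<^sub>c - \<nabla>\<^sub>b P\<^sub>a\<^sub>c\<close>, after cancellation of the terms symmetric in \<open>a b\<close>.\<close>

definition cotton :: "'n \<Rightarrow> 'n \<Rightarrow> 'n \<Rightarrow> 'a \<Rightarrow> real" where
  "cotton a b c x = (\<Sum>e\<in>UNIV. \<Gamma> e b c x * P a e x) - (\<Sum>e\<in>UNIV. \<Gamma> e a c x * P b e x)
     + pd \<kappa> a (P b c) x - pd \<kappa> b (P a c) x"

lemma smooth_cotton: "smooth (cotton a b c)"
  unfolding cotton_def[abs_def] by (intro smooth_intros smooth_christoffel smooth_schouten[OF dim])

lemma smooth_mu_up: "smooth (mu_up d)"
  unfolding mu_up_def[abs_def] by (intro smooth_intros smooth_ginv smooth_mu)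

lemma lower_mu_up:
  assumes "x \<in> fst \<kappa>"
  shows "(\<Sum>d\<in>UNIV. g \<kappa> x $ b $ d * mu_up d x) = \<mu> b x"
proof -
  have "(\<Sum>d\<in>UNIV. g \<kappa> x $ b $ d * mu_up d x) = (\<Sum>e\<in>UNIV. (\<Sum>d\<in>UNIV. g \<kappa> x $ b $ d * ginv g \<kappa> x $ d $ e) * \<mu> e x)"
    unfolding mu_up_def sum_distrib_left sum_distrib_right by (subst sum.swap) (simp add: mult.assoc)
  then show ?thesis by (simp add: g_ginv[OF assms] if_distrib[of "\<lambda>y. y * _"] cong: if_cong)
qed

lemma pd_mu:
  "x \<in> fst \<kappa> \<Longrightarrow> pd \<kappa> a (\<mu> b) x = (\<Sum>e\<in>UNIV. \<Gamma> e a b x * \<mu> e x) - g \<kappa> x $ a $ b * \<rho> x - P a b x * \<sigma> x"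
  using cov_mu[of x a b] by (simp add: cov_form_def)

text \<open>Grouped for antisymmetrisation in \<open>a b\<close>: the coefficient of \<mu> then
  gives the curvature and that of \<sigma> the Cotton tensor, while the coefficient of \<rho> is
  symmetric, so \<rho> drops out.\<close>

lemma pd_pd_mu:
  assumes x: "x \<in> fst \<kappa>"
  shows "pd \<kappa> a (pd \<kappa> b (\<mu> c)) x =
     (\<Sum>f\<in>UNIV. (pd \<kappa> a (\<Gamma> f b c) x + (\<Sum>e\<in>UNIV. \<Gamma> f a e x * \<Gamma> e b c x)) * \<mu> f x)
     - (christoffel_low a b c x + christoffel_low b a c x + christoffel_low c a b x) * \<rho> x
     - ((\<Sum>e\<in>UNIV. \<Gamma> e b c x * P a e x) + pd \<kappa> a (P b c) x) * \<sigma> x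
     - g \<kappa> x $ b $ c * (\<Sum>d\<in>UNIV. P a d x * mu_up d x) - P b c x * \<mu> a x"
proof -
  have "pd \<kappa> a (pd \<kappa> b (\<mu> c)) x =
      pd \<kappa> a (\<lambda>x. (\<Sum>e\<in>UNIV. \<Gamma> e b c x * \<mu> e x) - g \<kappa> x $ b $ c * \<rho> x - P b c x * \<sigma> x) x"
    by (rule pd_cong_region[OF _ x]) (rule pd_mu)
  also have "\<dots> = pd \<kappa> a (\<lambda>x. \<Sum>e\<in>UNIV. \<Gamma> e b c x * \<mu> e x) x - pd \<kappa> a (\<lambda>x. g \<kappa> x $ b $ c * \<rho> x) x
      - pd \<kappa> a (\<lambda>x. P b c x * \<sigma> x) x"
    by (subst pd_diff[OF _ _ x] pd_diff[OF _ _ x];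
        (intro smooth_intros smooth_christoffel smooth_mu smooth_g smooth_rho smooth_schouten[OF dim] smooth_sigma)?)+
      simp
  also have "pd \<kappa> a (\<lambda>x. \<Sum>e\<in>UNIV. \<Gamma> e b c x * \<mu> e x) x =
      (\<Sum>e\<in>UNIV. pd \<kappa> a (\<Gamma> e b c) x * \<mu> e x + \<Gamma> e b c x * pd \<kappa> a (\<mu> e) x)"
    by (subst pd_sum[OF smooth_mult[OF smooth_christoffel smooth_mu] x], intro sum.cong refl
        pd_mult smooth_christoffel smooth_mu x)
  also have "\<dots> = (\<Sum>e\<in>UNIV. pd \<kappa> a (\<Gamma> e b c) x * \<mu> e x)
      + (\<Sum>e\<in>UNIV. \<Gamma> e b c x * (\<Sum>f\<in>UNIV. \<Gamma> f a e x * \<mu> f x))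
      - (\<Sum>e\<in>UNIV. g \<kappa> x $ a $ e * \<Gamma> e b c x) * \<rho> x - (\<Sum>e\<in>UNIV. \<Gamma> e b c x * P a e x) * \<sigma> x"
    unfolding pd_mu[OF x] sum_distrib_right sum.distrib[symmetric] sum_subtractf[symmetric]
    by (intro sum.cong refl) (simp add: algebra_simps)
  also have "(\<Sum>e\<in>UNIV. \<Gamma> e b c x * (\<Sum>f\<in>UNIV. \<Gamma> f a e x * \<mu> f x)) =
      (\<Sum>f\<in>UNIV. (\<Sum>e\<in>UNIV. \<Gamma> f a e x * \<Gamma> e b c x) * \<mu> f x)"
    unfolding sum_distrib_left sum_distrib_right by (subst sum.swap) (simp add: mult_ac)
  also have "pd \<kappa> a (\<lambda>x. g \<kappa> x $ b $ c * \<rho> x) x = (christoffel_low b a c x + christoffel_low c a b x) * \<rho> x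
      + g \<kappa> x $ b $ c * (\<Sum>d\<in>UNIV. P a d x * mu_up d x)"
    unfolding pd_mult[OF smooth_g smooth_rho x] pd_g[OF x] pd_rho[OF x] mu_up_def ..
  also have "pd \<kappa> a (\<lambda>x. P b c x * \<sigma> x) x = pd \<kappa> a (P b c) x * \<sigma> x + P b c x * \<mu> a x"
    unfolding pd_mult[OF smooth_schouten[OF dim] smooth_sigma x] pd_sigma[OF x] ..
  finally show ?thesis
    by (simp add: christoffel_lower[OF x] sum.distrib distrib_right)
qed

text \<open>Commuting derivatives of \<mu> expresses the curvature contracted with \<mu>. The terms
  with P that appear are exactly those separating the Weyl tensor from the curvature, so only the
  Cotton term survives.\<close>

lemma weyl_mu_up:
  assumes x: "x \<in> fst \<kappa>"
  shows "(\<Sum>d\<in>UNIV. weyl g \<kappa> a b c d x * mu_up d x) = - (\<sigma> x * cotton a b c x)"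
proof -
  define T where "T a = (\<Sum>d\<in>UNIV. P a d x * mu_up d x)" for a
  have "(\<Sum>f\<in>UNIV. (pd \<kappa> a (\<Gamma> f b c) x + (\<Sum>e\<in>UNIV. \<Gamma> f a e x * \<Gamma> e b c x)) * \<mu> f x)
      - (\<Sum>f\<in>UNIV. (pd \<kappa> b (\<Gamma> f a c) x + (\<Sum>e\<in>UNIV. \<Gamma> f b e x * \<Gamma> e a c x)) * \<mu> f x)
      = \<sigma> x * cotton a b c x + g \<kappa> x $ b $ c * T a - g \<kappa> x $ a $ c * T b + P b c x * \<mu> a x - P a c x * \<mu> b x"
    using pd_commute[OF smooth_mu x, of a b c] christoffel_low_sym[OF x, of c a b]
    unfolding pd_pd_mu[OF x] T_def[symmetric]
    by (simp add: cotton_def algebra_simps)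
  also have "(\<Sum>f\<in>UNIV. (pd \<kappa> a (\<Gamma> f b c) x + (\<Sum>e\<in>UNIV. \<Gamma> f a e x * \<Gamma> e b c x)) * \<mu> f x)
      - (\<Sum>f\<in>UNIV. (pd \<kappa> b (\<Gamma> f a c) x + (\<Sum>e\<in>UNIV. \<Gamma> f b e x * \<Gamma> e a c x)) * \<mu> f x)
      = (\<Sum>f\<in>UNIV. curv_up g \<kappa> a b f c x * \<mu> f x)"
    unfolding sum_subtractf[symmetric] curv_up_christoffel[OF x]
    by (intro sum.cong refl) (simp add: algebra_simps)
  also have "\<dots> = (\<Sum>f\<in>UNIV. \<Sum>d\<in>UNIV. g \<kappa> x $ d $ f * curv_up g \<kappa> a b f c x * mu_up d x)"
    by (subst lower_mu_up[OF x, symmetric], simp add: sum_distrib_left, intro sum.cong refl)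
      (simp add: g_sym[OF x] mult_ac)
  also have "\<dots> = (\<Sum>d\<in>UNIV. curv g \<kappa> a b d c x * mu_up d x)"
    by (subst sum.swap) (simp add: curv_def sum_distrib_right)
  \<comment> \<open>The curvature acts on a form here, which leaves the contracted index third;
    moving it to the last slot produces the sign.\<close>
  also have "\<dots> = - (\<Sum>d\<in>UNIV. curv g \<kappa> a b c d x * mu_up d x)"
    by (simp add: curv_antisym2[OF x, of a b c] sum_negf)
  finally have R: "(\<Sum>d\<in>UNIV. curv g \<kappa> a b c d x * mu_up d x) =
    - (\<sigma> x * cotton a b c x + g \<kappa> x $ b $ c * T a - g \<kappa> x $ a $ c * T b + P b c x * \<mu> a x - P a c x * \<mu> b x)"
    by simp
  have "(\<Sum>d\<in>UNIV. weyl g \<kappa> a b c d x * mu_up d x) = (\<Sum>d\<in>UNIV. curv g \<kappa> a b c d x * mu_up d x)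
      - g \<kappa> x $ a $ c * T b + g \<kappa> x $ b $ c * T a
      - P a c x * (\<Sum>d\<in>UNIV. g \<kappa> x $ b $ d * mu_up d x) + P b c x * (\<Sum>d\<in>UNIV. g \<kappa> x $ a $ d * mu_up d x)"
    unfolding T_def sum_distrib_left sum.distrib[symmetric] sum_subtractf[symmetric]
    by (intro sum.cong refl)
      (simp add: weyl_def weyl_of_def g_sym[OF x, of c] g_sym[OF x, of _ a] g_sym[OF x, of _ b] algebra_simps)
  then show ?thesis unfolding R lower_mu_up[OF x] by simp
qed

text \<open>Weak genericity kills \<open>\<mu>\<close> at a zero of \<open>\<sigma>\<close> by the previous identity; its first derivative
  there reduces to \<open>\<rho> C = 0\<close>.\<close>

lemma zero_of_sigma:
  assumes x: "x \<in> fst \<kappa>" and zero: "\<sigma> x = 0"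
    and generic: "\<And>V::real^'n. (\<forall>a b c. (\<Sum>d\<in>UNIV. weyl g \<kappa> a b c d x * V $ d) = 0) \<Longrightarrow> V = 0"
  shows "\<mu> a x = 0" and "\<rho> x = 0"
proof -
  have "(\<chi> d. mu_up d x) = 0"
    by (rule generic) (simp add: weyl_mu_up[OF x] zero)
  then have up: "mu_up d x = 0" for d by (simp add: vec_eq_iff)
  then have mu: "\<mu> a x = 0" for a using lower_mu_up[OF x, of a] by simp
  then show "\<mu> a x = 0" .
  \<comment> \<open>At \<open>x\<close> everything except the term of \<open>pd_mu\<close> with
    \<rho> carries a factor \<mu> or \<sigma>; raising the index turns the metric into a Kronecker
    delta.\<close>
  have pd_up: "pd \<kappa> f (mu_up d) x = - (\<rho> x * (if d = f then 1 else 0))" for d f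
  proof -
    have "pd \<kappa> f (mu_up d) x = (\<Sum>e\<in>UNIV. pd \<kappa> f (\<lambda>x. ginv g \<kappa> x $ d $ e) x * \<mu> e x
        + ginv g \<kappa> x $ d $ e * pd \<kappa> f (\<mu> e) x)"
      unfolding mu_up_def[abs_def]
      by (subst pd_sum[OF smooth_mult[OF smooth_ginv smooth_mu] x], intro sum.cong refl
          pd_mult smooth_ginv smooth_mu x)
    also have "\<dots> = (\<Sum>e\<in>UNIV. - (\<rho> x * (ginv g \<kappa> x $ d $ e * g \<kappa> x $ e $ f)))"
      by (intro sum.cong refl) (simp add: mu zero pd_mu[OF x] g_sym[OF x, of f])
    also have "\<dots> = - (\<rho> x * (\<Sum>e\<in>UNIV. ginv g \<kappa> x $ d $ e * g \<kappa> x $ e $ f))"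
      by (simp add: sum_negf sum_distrib_left)
    finally show ?thesis by (simp only: ginv_g[OF x])
  qed
  have "weyl g \<kappa> a b c f x * \<rho> x = 0" for a b c f
  proof -
    have "pd \<kappa> f (\<lambda>y. \<Sum>d\<in>UNIV. weyl g \<kappa> a b c d y * mu_up d y) x =
        (\<Sum>d\<in>UNIV. pd \<kappa> f (weyl g \<kappa> a b c d) x * mu_up d x + weyl g \<kappa> a b c d x * pd \<kappa> f (mu_up d) x)"
      by (subst pd_sum[OF smooth_mult[OF smooth_weyl[OF dim] smooth_mu_up] x], intro sum.cong refl
          pd_mult smooth_weyl[OF dim] smooth_mu_up x)
    also have "\<dots> = - (weyl g \<kappa> a b c f x * \<rho> x)"
      by (simp add: up pd_up sum_negf if_distrib[of "\<lambda>y. _ * y"] cong: if_cong)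
    finally have eq: "pd \<kappa> f (\<lambda>y. \<Sum>d\<in>UNIV. weyl g \<kappa> a b c d y * mu_up d y) x = - (weyl g \<kappa> a b c f x * \<rho> x)" .
    have "pd \<kappa> f (\<lambda>y. \<Sum>d\<in>UNIV. weyl g \<kappa> a b c d y * mu_up d y) x = pd \<kappa> f (\<lambda>y. - (\<sigma> y * cotton a b c y)) x"
      by (rule pd_cong_region[OF weyl_mu_up x])
    \<comment> \<open>The product rule leaves \<mu> times the Cotton tensor plus \<sigma> times its
      derivative, and both factors vanish at \<open>x\<close>.\<close>
    also have "\<dots> = 0"
      by (simp add: pd_minus[OF smooth_mult[OF smooth_sigma smooth_cotton] x]
          pd_mult[OF smooth_sigma smooth_cotton x] pd_sigma[OF x] mu zero)
    finally show ?thesis using eq by simp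
  qed
  \<comment> \<open>Otherwise the Weyl tensor vanishes at \<open>x\<close> and annihilates a
    non-zero coordinate vector, contrary to \<open>generic\<close>.\<close>
  then show "\<rho> x = 0"
    using generic[of "axis k 1" for k] by (cases "\<rho> x = 0") (auto simp: axis_eq_0_iff)
qed

text \<open>The parallel equations give all first derivatives of \<sigma>, \<mu> and \<rho> linearly
  in these functions, so a common zero propagates.\<close>

lemma zero_near:
  assumes x: "x \<in> fst \<kappa>" and zero: "\<sigma> x = 0" "\<And>a. \<mu> a x = 0" "\<rho> x = 0"
  shows "\<exists>V. open V \<and> snd \<kappa> x \<in> V \<and> (\<forall>y\<in>fst \<kappa>. snd \<kappa> y \<in> V \<longrightarrow> \<sigma> y = 0)"
proof -
  \<comment> \<open>The type \<open>'n option option\<close> indexes the n + 2 components of a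
    tractor: \<open>None\<close> for \<sigma>, \<open>Some None\<close> for \<rho>, the rest for
    \<mu>.\<close>
  define u where "u i = (case i of None \<Rightarrow> \<sigma> | Some None \<Rightarrow> \<rho> | Some (Some b) \<Rightarrow> \<mu> b)" for i
  define M where "M a i j = (case i of
        None \<Rightarrow> (\<lambda>x. if j = Some (Some a) then 1 else 0)
      | Some None \<Rightarrow> (case j of Some (Some c) \<Rightarrow> (\<lambda>x. \<Sum>b\<in>UNIV. P a b x * ginv g \<kappa> x $ b $ c) | _ \<Rightarrow> (\<lambda>x. 0))
      | Some (Some b) \<Rightarrow> (case j of None \<Rightarrow> (\<lambda>x. - P a b x) | Some None \<Rightarrow> (\<lambda>x. - g \<kappa> x $ a $ b)
          | Some (Some e) \<Rightarrow> \<Gamma> e a b))" for a i j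
  have sum_option: "(\<Sum>j\<in>UNIV. f j) = f None + (\<Sum>j\<in>UNIV. f (Some j))" for f :: "'k::finite option \<Rightarrow> real"
    by (simp add: UNIV_option_conv sum.reindex)
  have "\<exists>V. open V \<and> snd \<kappa> x \<in> V \<and> (\<forall>y\<in>fst \<kappa>. snd \<kappa> y \<in> V \<longrightarrow> (\<forall>i. u i y = 0))"
  proof (rule linear_system_zero_region[OF x, of u M])
    show "smooth (u i)" for i
      using smooth_sigma smooth_mu smooth_rho by (auto simp: u_def split: option.split)
    show "smooth (M a i j)" for a i j
      unfolding M_def
      by (auto split: option.split intro!: smooth_intros smooth_g smooth_ginv smooth_schouten[OF dim] smooth_christoffel)
    show "u i x = 0" for i using zero by (auto simp: u_def split: option.split)
    fix a i y assume y: "y \<in> fst \<kappa>"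
    have "(\<Sum>b\<in>UNIV. P a b y * (\<Sum>c\<in>UNIV. ginv g \<kappa> y $ b $ c * \<mu> c y)) =
        (\<Sum>c\<in>UNIV. (\<Sum>b\<in>UNIV. P a b y * ginv g \<kappa> y $ b $ c) * \<mu> c y)"
      unfolding sum_distrib_left sum_distrib_right by (subst sum.swap) (simp add: mult.assoc)
    then show "pd \<kappa> a (u i) y = (\<Sum>j\<in>UNIV. M a i j y * u j y)"
      unfolding sum_option
      by (auto simp: u_def M_def pd_sigma[OF y] pd_rho[OF y] pd_mu[OF y] if_distrib[of "\<lambda>y. y * _"]
          split: option.split cong: if_cong)
  qed
  then obtain V where "open V" "snd \<kappa> x \<in> V" "\<forall>y\<in>fst \<kappa>. snd \<kappa> y \<in> V \<longrightarrow> (\<forall>i. u i y = 0)" by blast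
  moreover have "u None = \<sigma>" by (simp add: u_def)
  ultimately show ?thesis by (intro exI[of _ V]) metis
qed

text \<open>The square is prescribed because the sign of \<sigma> is unknown. Differentiating it
  kills \<mu>, and multiplying the middle parallel equation by \<sigma> then solves it for
  P.\<close>

lemma unit_scale_einstein:
  assumes x: "x \<in> fst \<kappa>" and unit: "\<And>y. y \<in> fst \<kappa> \<Longrightarrow> \<sigma> y * \<sigma> y = 1"
  shows "schouten g \<kappa> x $ a $ b - (1 / real CARD('n)) * trace_schouten g \<kappa> x * g \<kappa> x $ a $ b = 0"
proof -
  have mu: "\<mu> c y = 0" if y: "y \<in> fst \<kappa>" for c y
  proof -
    have "pd \<kappa> c (\<lambda>y. \<sigma> y * \<sigma> y) y = pd \<kappa> c (\<lambda>y. 1) y"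
      by (rule pd_cong_region[OF unit y])
    then have "2 * (\<mu> c y * \<sigma> y) = 0"
      unfolding pd_mult[OF smooth_sigma smooth_sigma y] pd_sigma[OF y] by auto
    then show ?thesis using unit[OF y] by (metis mult_eq_0_iff zero_neq_numeral zero_neq_one)
  qed
  have "P a b x = - (\<sigma> x * \<rho> x) * g \<kappa> x $ a $ b" for a b
  proof -
    have "pd \<kappa> a (\<mu> b) x = pd \<kappa> a (\<lambda>y. 0) x" by (rule pd_cong_region[OF mu x])
    then have "g \<kappa> x $ a $ b * \<rho> x + P a b x * \<sigma> x = 0"
      using pd_mu[OF x, of a b] mu[OF x] by simp
    then have "(g \<kappa> x $ a $ b * \<rho> x + P a b x * \<sigma> x) * \<sigma> x = 0" by simp
    then have "\<sigma> x * \<rho> x * g \<kappa> x $ a $ b + (\<sigma> x * \<sigma> x) * P a b x = 0"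
      by (simp add: algebra_simps)
    then show ?thesis unfolding unit[OF x] by (simp add: eq_neg_iff_add_eq_0 add.commute)
  qed
  note P = this
  have "trace_schouten g \<kappa> x = (\<Sum>a\<in>UNIV. \<Sum>b\<in>UNIV. - (\<sigma> x * \<rho> x) * (ginv g \<kappa> x $ a $ b * g \<kappa> x $ b $ a))"
    unfolding trace_schouten_def P by (intro sum.cong refl) (simp add: g_sym[OF x])
  also have "\<dots> = - (\<sigma> x * \<rho> x) * real CARD('n)"
    by (simp only: sum_distrib_left[symmetric] contract_g[OF x])
  finally show ?thesis by (simp add: P)
qed

end

section \<open>Conformal manifolds\<close>

locale conformal_structure =
  fixes X :: "'a topology" and A :: "('a, 'n::finite) chart set" and \<C> :: "('a, 'n) metric set"
  assumes conf: "conformal_manifold X A \<C>"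
begin

lemma
  assumes "\<kappa> \<in> A"
  shows chart_openin: "openin X (fst \<kappa>)"
    and chart_open_image: "open (snd \<kappa> ` fst \<kappa>)"
    and chart_homeomorphic: "homeomorphic_map (subtopology X (fst \<kappa>)) (top_of_set (snd \<kappa> ` fst \<kappa>)) (snd \<kappa>)"
  using conf assms unfolding conformal_manifold_def smooth_manifold_def smooth_atlas_def by blast+

lemma chart_subset: "\<kappa> \<in> A \<Longrightarrow> fst \<kappa> \<subseteq> topspace X"
  using chart_openin openin_subset by blast

lemma chart_exists: "x \<in> topspace X \<Longrightarrow> \<exists>\<kappa>\<in>A. x \<in> fst \<kappa>"
  using conf unfolding conformal_manifold_def smooth_manifold_def smooth_atlas_def by blast

lemma chart_region_Int:
  assumes "\<kappa> \<in> A" "openin X W"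
  shows "chart_region \<kappa> (fst \<kappa> \<inter> W)"
proof
  show "inj_on (snd \<kappa>) (fst \<kappa>)"
    using homeomorphic_imp_injective_map[OF chart_homeomorphic[OF assms(1)]] chart_subset[OF assms(1)]
    by (simp add: Int_absorb1)
  have "openin (subtopology X (fst \<kappa>)) (fst \<kappa> \<inter> W)"
    using assms chart_openin by (simp add: openin_open_subtopology openin_Int)
  then have "openin (top_of_set (snd \<kappa> ` fst \<kappa>)) (snd \<kappa> ` (fst \<kappa> \<inter> W))"
    using homeomorphic_imp_open_map[OF chart_homeomorphic[OF assms(1)]] unfolding open_map_def by blast
  then show "open (snd \<kappa> ` (fst \<kappa> \<inter> W))"
    using chart_open_image[OF assms(1)] openin_open_trans by blast
qed simp

lemma chart_region: "\<kappa> \<in> A \<Longrightarrow> chart_region \<kappa> (fst \<kappa>)"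
  using chart_region_Int[OF _ chart_openin, of \<kappa> \<kappa>] by simp

lemma smooth_const: "\<kappa> \<in> A \<Longrightarrow> smooth_in \<kappa> (fst \<kappa>) (\<lambda>_. c)"
  using chart_region.smooth_const[OF chart_region] .

lemma openin_preimage:
  assumes "\<kappa> \<in> A" "open V"
  shows "openin X {y \<in> fst \<kappa>. snd \<kappa> y \<in> V}"
proof -
  have "openin (top_of_set (snd \<kappa> ` fst \<kappa>)) (snd \<kappa> ` fst \<kappa> \<inter> V)"
    using assms(2) by auto
  from openin_continuous_map_preimage[OF homeomorphic_imp_continuous_map[OF chart_homeomorphic[OF assms(1)]] this]
  have "openin (subtopology X (fst \<kappa>)) {y \<in> topspace X \<inter> fst \<kappa>. snd \<kappa> y \<in> snd \<kappa> ` fst \<kappa> \<inter> V}"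
    by simp
  moreover have "{y \<in> topspace X \<inter> fst \<kappa>. snd \<kappa> y \<in> snd \<kappa> ` fst \<kappa> \<inter> V} = {y \<in> fst \<kappa>. snd \<kappa> y \<in> V}"
    using chart_subset[OF assms(1)] by auto
  ultimately show ?thesis using chart_openin[OF assms(1)] openin_trans_full by metis
qed

lemma smooth_fun_topspace: "smooth_fun A (topspace X) f \<longleftrightarrow> (\<forall>\<kappa>\<in>A. smooth_in \<kappa> (fst \<kappa>) f)"
proof -
  have "fst \<kappa> \<inter> topspace X = fst \<kappa>" if "\<kappa> \<in> A" for \<kappa>
    using chart_subset[OF that] by blast
  then show ?thesis by (simp add: smooth_fun_def smooth_in_def)
qed

section \<open>The conformal class of metrics\<close>

lemma metric_of_class: "g \<in> \<C> \<Longrightarrow> is_metric A g"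
  using conf by (auto simp: conformal_manifold_def conformal_class_def)

lemma metric_chart:
  assumes "g \<in> \<C>" "\<kappa> \<in> A"
  shows "metric_chart \<kappa> g"
  using metric_of_class[OF assms(1)] assms(2) chart_region[OF assms(2)]
  unfolding is_metric_def metric_chart_def metric_chart_axioms_def by blast

text \<open>Two metrics of the class will be compared through the common base metric, which avoids
  inverting a scale factor.\<close>

lemma class_representative:
  obtains g0 where "g0 \<in> \<C>" "\<And>g. g \<in> \<C> \<longleftrightarrow> is_metric A g \<and> (\<exists>\<Omega>. rescales A \<Omega> g0 g)"
proof -
  obtain g0 where g0: "is_metric A g0" "\<C> = conformal_class A g0"
    using conf by (auto simp: conformal_manifold_def)
  have "rescales A (\<lambda>x. 1) g0 g0"
    unfolding rescales_def using smooth_const by simp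
  then have "g0 \<in> \<C>" using g0 by (auto simp: conformal_class_def)
  then show ?thesis using that g0 by (auto simp: conformal_class_def)
qed

lemma rescaled_metric:
  assumes "g \<in> \<C>" "rescales A \<Omega> g g'"
  shows "g' \<in> \<C>"
proof -
  obtain g0 where g0: "\<And>g. g \<in> \<C> \<longleftrightarrow> is_metric A g \<and> (\<exists>\<Omega>. rescales A \<Omega> g0 g)"
    using class_representative by blast
  obtain \<Omega>0 where \<Omega>0: "rescales A \<Omega>0 g0 g" using assms(1) g0 by blast
  have "rescales A (\<lambda>x. \<Omega> x * \<Omega>0 x) g0 g'"
    using \<Omega>0 assms(2) chart_region chart_region.smooth_mult
    unfolding rescales_def by (fastforce simp: power_mult_distrib)
  moreover have "is_metric A g'"
    unfolding is_metric_def
  proof (intro conjI ballI allI)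
    fix \<kappa> a b assume \<kappa>: "\<kappa> \<in> A"
    interpret metric_chart \<kappa> g using metric_chart assms(1) \<kappa> .
    have "smooth (\<lambda>x. (\<Omega> x * \<Omega> x) * g \<kappa> x $ a $ b)"
      using assms(2) \<kappa> by (intro smooth_mult smooth_g) (auto simp: rescales_def)
    then show "smooth (\<lambda>x. g' \<kappa> x $ a $ b)"
      by (rule smooth_cong) (use assms(2) \<kappa> in \<open>auto simp: rescales_def power2_eq_square\<close>)
  next
    fix \<kappa> x assume \<kappa>: "\<kappa> \<in> A" "x \<in> fst \<kappa>"
    interpret metric_chart \<kappa> g using metric_chart assms(1) \<kappa>(1) .
    have g': "g' \<kappa> x = (\<Omega> x)\<^sup>2 *\<^sub>R g \<kappa> x" "\<Omega> x > 0" using assms(2) \<kappa> by (auto simp: rescales_def)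
    show "transpose (g' \<kappa> x) = g' \<kappa> x"
      using g_sym[OF \<kappa>(2)] by (simp add: g' vec_eq_iff transpose_def)
    show "invertible (g' \<kappa> x)"
      using scalar_invertible[OF _ invertible_g[OF \<kappa>(2)], of "(\<Omega> x)\<^sup>2"] g' by simp
  next
    fix \<kappa> \<kappa>' x a b assume \<kappa>: "\<kappa> \<in> A" "\<kappa>' \<in> A" "x \<in> fst \<kappa> \<inter> fst \<kappa>'"
    have g': "g' \<kappa> x = (\<Omega> x)\<^sup>2 *\<^sub>R g \<kappa> x" "g' \<kappa>' x = (\<Omega> x)\<^sup>2 *\<^sub>R g \<kappa>' x"
      using assms(2) \<kappa> by (auto simp: rescales_def)
    have "g \<kappa>' x $ a $ b = (\<Sum>c\<in>UNIV. \<Sum>d\<in>UNIV. pd \<kappa>' a (\<lambda>y. snd \<kappa> y $ c) x * pd \<kappa>' b (\<lambda>y. snd \<kappa> y $ d) x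
             * g \<kappa> x $ c $ d)"
      using metric_of_class[OF assms(1)] \<kappa> unfolding is_metric_def by blast
    then show "g' \<kappa>' x $ a $ b = (\<Sum>c\<in>UNIV. \<Sum>d\<in>UNIV. pd \<kappa>' a (\<lambda>y. snd \<kappa> y $ c) x * pd \<kappa>' b (\<lambda>y. snd \<kappa> y $ d) x
             * g' \<kappa> x $ c $ d)"
      by (simp add: g' sum_distrib_left mult_ac)
  qed
  ultimately show ?thesis using g0 by blast
qed

subsection \<open>Tractors as classes of local densities\<close>

abbreviation "loc x \<equiv> local_densities X A \<C> 1 x"

lemma same_1jet_sym: "same_1jet A \<C> x \<sigma> \<tau> \<Longrightarrow> same_1jet A \<C> x \<tau> \<sigma>"
  by (simp add: same_1jet_def)

lemma same_1jet_trans: "same_1jet A \<C> x \<sigma> \<tau> \<Longrightarrow> same_1jet A \<C> x \<tau> \<upsilon> \<Longrightarrow> same_1jet A \<C> x \<sigma> \<upsilon>"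
  by (simp add: same_1jet_def)

lemma hessian_diff_self [simp]: "hessian_diff g \<kappa> x \<sigma> \<sigma> = 0"
  by (simp add: hessian_diff_def vec_eq_iff)

lemma hessian_diff_swap: "hessian_diff g \<kappa> x \<tau> \<sigma> = - hessian_diff g \<kappa> x \<sigma> \<tau>"
  by (simp add: hessian_diff_def vec_eq_iff)

lemma hessian_diff_add: "hessian_diff g \<kappa> x \<sigma> \<tau> + hessian_diff g \<kappa> x \<tau> \<upsilon> = hessian_diff g \<kappa> x \<sigma> \<upsilon>"
  by (simp add: hessian_diff_def vec_eq_iff)

lemma jet2_rel_iff: "(\<sigma>, \<tau>) \<in> jet2_rel X A \<C> x \<longleftrightarrow> \<sigma> \<in> loc x \<and> \<tau> \<in> loc x \<and> same_1jet A \<C> x \<sigma> \<tau> \<and>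
    (\<forall>g\<in>\<C>. \<forall>\<kappa>\<in>A. x \<in> fst \<kappa> \<longrightarrow> hessian_diff g \<kappa> x \<sigma> \<tau> = 0)"
  by (simp add: jet2_rel_def)

lemma equiv_jet2_rel: "equiv (loc x) (jet2_rel X A \<C> x)"
proof (rule equivI)
  show "jet2_rel X A \<C> x \<subseteq> loc x \<times> loc x" by (auto simp: jet2_rel_def)
  show "refl_on (loc x) (jet2_rel X A \<C> x)"
    by (simp add: refl_on_def jet2_rel_iff same_1jet_def)
  show "sym (jet2_rel X A \<C> x)"
    unfolding sym_def jet2_rel_iff using same_1jet_sym hessian_diff_swap[of _ _ x] by (metis neg_equal_0_iff_equal)
  show "trans (jet2_rel X A \<C> x)"
    unfolding trans_def jet2_rel_iff using same_1jet_trans hessian_diff_add[of _ _ x] by (metis add.right_neutral)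
qed

definition trace_free_sym :: "'a \<Rightarrow> ('a, 'n) density \<Rightarrow> ('a, 'n) density \<Rightarrow> bool" where
  "trace_free_sym x \<sigma> \<tau> \<longleftrightarrow> (\<forall>g\<in>\<C>. \<forall>\<kappa>\<in>A. x \<in> fst \<kappa> \<longrightarrow>
     transpose (hessian_diff g \<kappa> x \<sigma> \<tau>) = hessian_diff g \<kappa> x \<sigma> \<tau> \<and>
     (\<Sum>a\<in>UNIV. \<Sum>b\<in>UNIV. ginv g \<kappa> x $ a $ b * hessian_diff g \<kappa> x \<sigma> \<tau> $ a $ b) = 0)"

lemma tractor_rel_iff: "(j, k) \<in> tractor_rel X A \<C> x \<longleftrightarrow>
    j \<in> jet2_fibre X A \<C> x \<and> k \<in> jet2_fibre X A \<C> x \<and>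
    (\<exists>\<sigma>\<in>j. \<exists>\<tau>\<in>k. same_1jet A \<C> x \<sigma> \<tau> \<and> trace_free_sym x \<sigma> \<tau>)"
  by (simp add: tractor_rel_def trace_free_sym_def)

lemma trace_free_sym_swap:
  assumes "trace_free_sym x \<sigma> \<tau>"
  shows "trace_free_sym x \<tau> \<sigma>"
  using assms unfolding trace_free_sym_def hessian_diff_swap[of _ _ x \<tau> \<sigma>]
  by (simp add: vec_eq_iff transpose_def sum_negf)

lemma trace_free_sym_add:
  assumes "trace_free_sym x \<sigma> \<tau>" "trace_free_sym x \<tau> \<upsilon>"
  shows "trace_free_sym x \<sigma> \<upsilon>"
  using assms unfolding trace_free_sym_def hessian_diff_add[of _ _ x \<sigma> \<tau> \<upsilon>, symmetric]
  by (simp add: vec_eq_iff transpose_def distrib_left sum.distrib)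

lemma jet2_rel_trace_free_sym: "(\<sigma>, \<tau>) \<in> jet2_rel X A \<C> x \<Longrightarrow> same_1jet A \<C> x \<sigma> \<tau> \<and> trace_free_sym x \<sigma> \<tau>"
  by (simp add: jet2_rel_def trace_free_sym_def vec_eq_iff transpose_def)

lemma jet2_fibre_related:
  assumes "j \<in> jet2_fibre X A \<C> x" "\<sigma> \<in> j" "\<tau> \<in> j"
  shows "(\<sigma>, \<tau>) \<in> jet2_rel X A \<C> x"
  using assms quotient_eq_iff[OF equiv_jet2_rel, of j x j \<sigma> \<tau>] unfolding jet2_fibre_def by blast

lemma equiv_tractor_rel: "equiv (jet2_fibre X A \<C> x) (tractor_rel X A \<C> x)"
proof (rule equivI)
  show "tractor_rel X A \<C> x \<subseteq> jet2_fibre X A \<C> x \<times> jet2_fibre X A \<C> x"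
    by (auto simp: tractor_rel_iff)
  show "refl_on (jet2_fibre X A \<C> x) (tractor_rel X A \<C> x)"
    unfolding refl_on_def
  proof
    fix j assume j: "j \<in> jet2_fibre X A \<C> x"
    then obtain \<sigma> where "\<sigma> \<in> j"
      using in_quotient_imp_non_empty[OF equiv_jet2_rel] unfolding jet2_fibre_def by blast
    then show "(j, j) \<in> tractor_rel X A \<C> x"
      using j by (auto simp: tractor_rel_iff jet2_rel_trace_free_sym jet2_fibre_related)
  qed
  show "sym (tractor_rel X A \<C> x)"
    unfolding sym_def tractor_rel_iff using same_1jet_sym trace_free_sym_swap by blast
  show "trans (tractor_rel X A \<C> x)"
  proof (rule transI)
    fix j k l assume jk: "(j, k) \<in> tractor_rel X A \<C> x" and kl: "(k, l) \<in> tractor_rel X A \<C> x"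
    obtain \<sigma> \<tau> where 1: "\<sigma> \<in> j" "\<tau> \<in> k" "same_1jet A \<C> x \<sigma> \<tau>" "trace_free_sym x \<sigma> \<tau>"
      using jk unfolding tractor_rel_iff by blast
    obtain \<tau>' \<upsilon> where 2: "\<tau>' \<in> k" "\<upsilon> \<in> l" "same_1jet A \<C> x \<tau>' \<upsilon>" "trace_free_sym x \<tau>' \<upsilon>"
      using kl unfolding tractor_rel_iff by blast
    \<comment> \<open>The two relations may use different members of the middle jet
      \<open>k\<close>; being 2-jet equivalent, these differ by a zero Hessian and can be
      bridged.\<close>
    have "(\<tau>, \<tau>') \<in> jet2_rel X A \<C> x"
      using jk 1 2 jet2_fibre_related unfolding tractor_rel_iff by blast
    then have 3: "same_1jet A \<C> x \<tau> \<tau>'" "trace_free_sym x \<tau> \<tau>'"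
      using jet2_rel_trace_free_sym by blast+
    have "same_1jet A \<C> x \<sigma> \<upsilon>" "trace_free_sym x \<sigma> \<upsilon>"
      using same_1jet_trans[OF 1(3) same_1jet_trans[OF 3(1) 2(3)]]
        trace_free_sym_add[OF 1(4) trace_free_sym_add[OF 3(2) 2(4)]] .
    then show "(j, l) \<in> tractor_rel X A \<C> x"
      using 1 2 jk kl unfolding tractor_rel_iff by blast
  qed
qed

lemma tractor_class_eqI:
  assumes "\<sigma> \<in> loc x" "\<tau> \<in> loc x" "same_1jet A \<C> x \<sigma> \<tau>" "trace_free_sym x \<sigma> \<tau>"
  shows "tractor_class X A \<C> x \<sigma> = tractor_class X A \<C> x \<tau>"
proof -
  have "\<sigma> \<in> jet2_rel X A \<C> x `` {\<sigma>}" "\<tau> \<in> jet2_rel X A \<C> x `` {\<tau>}"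
    using assms equiv_class_self[OF equiv_jet2_rel] by blast+
  then have "(jet2_rel X A \<C> x `` {\<sigma>}, jet2_rel X A \<C> x `` {\<tau>}) \<in> tractor_rel X A \<C> x"
    using assms unfolding tractor_rel_iff jet2_fibre_def by (auto intro: quotientI)
  then show ?thesis
    unfolding tractor_class_def by (rule equiv_class_eq[OF equiv_tractor_rel])
qed

text \<open>Nonemptiness of the classes makes the choice in \<open>representative\<close>
  meaningful, and any member of any jet in \<open>t\<close> determines \<open>t\<close>
  again.\<close>

lemma representative_tractor:
  assumes "t \<in> tractor_fibre X A \<C> x"
  shows "representative t \<in> loc x" and "t = tractor_class X A \<C> x (representative t)"
proof -
  obtain j where j: "t = tractor_rel X A \<C> x `` {j}" "j \<in> jet2_fibre X A \<C> x"
    using assms unfolding tractor_fibre_def by (auto elim: quotientE)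
  have "j \<in> t" using j equiv_class_self[OF equiv_tractor_rel] by blast
  moreover obtain \<sigma> where "\<sigma> \<in> j"
    using j(2) in_quotient_imp_non_empty[OF equiv_jet2_rel] unfolding jet2_fibre_def by blast
  ultimately have "\<exists>\<sigma>. \<exists>j\<in>t. \<sigma> \<in> j" by blast
  then have "\<exists>j\<in>t. representative t \<in> j"
    unfolding representative_def by (rule someI_ex)
  then obtain k where k: "(j, k) \<in> tractor_rel X A \<C> x" "representative t \<in> k"
    using j(1) by blast
  have "k \<in> loc x // jet2_rel X A \<C> x" using k(1) by (simp add: tractor_rel_iff jet2_fibre_def)
  then obtain \<tau> where \<tau>: "k = jet2_rel X A \<C> x `` {\<tau>}" by (auto elim: quotientE)
  then have r: "(\<tau>, representative t) \<in> jet2_rel X A \<C> x" using k(2) by blast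
  then show "representative t \<in> loc x" by (simp add: jet2_rel_def)
  have "k = jet2_rel X A \<C> x `` {representative t}"
    using \<tau> equiv_class_eq[OF equiv_jet2_rel r] by simp
  then show "t = tractor_class X A \<C> x (representative t)"
    using j(1) equiv_class_eq[OF equiv_tractor_rel k(1)] by (simp add: tractor_class_def)
qed

lemma zero_density_loc:
  assumes "x \<in> topspace X"
  shows "(\<lambda>_ _. 0) \<in> loc x"
proof -
  have "density_on A \<C> 1 (topspace X) (\<lambda>_ _. 0)"
    unfolding density_on_def smooth_fun_topspace using smooth_const by simp
  then show ?thesis using assms unfolding local_densities_def by blast
qed

text \<open>Once the gradient vanishes, the Christoffel terms leave the Laplacian, which becomes the
  trace of the plain Hessian. The 2-jet then lies in the trace-free symmetric part that the tractor
  bundle divides out.\<close>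

lemma zero_tractorI:
  assumes x: "x \<in> topspace X" and \<tau>: "\<tau> \<in> loc x"
    and zero: "\<And>g \<kappa>. g \<in> \<C> \<Longrightarrow> \<kappa> \<in> A \<Longrightarrow> x \<in> fst \<kappa> \<Longrightarrow>
      \<tau> g x = 0 \<and> (\<forall>a. pd \<kappa> a (\<tau> g) x = 0) \<and> laplacian g \<kappa> (\<tau> g) x = 0"
  shows "tractor_class X A \<C> x \<tau> = zero_tractor X A \<C> x"
  unfolding zero_tractor_def
proof (rule tractor_class_eqI[OF \<tau> zero_density_loc[OF x]])
  have pd0: "pd \<kappa> b (\<lambda>_. 0) = (\<lambda>_. 0)" if "\<kappa> \<in> A" for \<kappa> b
    using chart_region.pd_const[OF chart_region[OF that]] by blast
  show "same_1jet A \<C> x \<tau> (\<lambda>_ _. 0)"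
    unfolding same_1jet_def using zero pd0 by simp
  show "trace_free_sym x \<tau> (\<lambda>_ _. 0)"
    unfolding trace_free_sym_def
  proof (intro ballI impI conjI)
    fix g \<kappa> assume g: "g \<in> \<C>" and \<kappa>: "\<kappa> \<in> A" "x \<in> fst \<kappa>"
    \<comment> \<open>The representative is smooth only on some neighbourhood \<open>W\<close>, so
      second derivatives are commuted in the region \<open>fst \<kappa> \<inter> W\<close>.\<close>
    obtain W where W: "openin X W" "x \<in> W" "density_on A \<C> 1 W \<tau>"
      using \<tau> unfolding local_densities_def by blast
    interpret chart_region \<kappa> "fst \<kappa> \<inter> W" using chart_region_Int \<kappa>(1) W(1) .
    have "smooth_in \<kappa> (fst \<kappa> \<inter> W) (\<tau> g)"
      using W(3) g \<kappa>(1) unfolding density_on_def smooth_fun_def by (simp add: smooth_in_def)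
    then have sym: "pd \<kappa> a (pd \<kappa> b (\<tau> g)) x = pd \<kappa> b (pd \<kappa> a (\<tau> g)) x" for a b
      using pd_commute \<kappa>(2) W(2) by blast
    have H: "hessian_diff g \<kappa> x \<tau> (\<lambda>_ _. 0) = (\<chi> a b. pd \<kappa> a (pd \<kappa> b (\<tau> g)) x)"
      by (simp add: hessian_diff_def pd0[OF \<kappa>(1)])
    show "transpose (hessian_diff g \<kappa> x \<tau> (\<lambda>_ _. 0)) = hessian_diff g \<kappa> x \<tau> (\<lambda>_ _. 0)"
      unfolding H vec_eq_iff transpose_def using sym by simp
    have "laplacian g \<kappa> (\<tau> g) x = 0" and "\<And>a. pd \<kappa> a (\<tau> g) x = 0" using zero g \<kappa> by blast+
    then show "(\<Sum>a\<in>UNIV. \<Sum>b\<in>UNIV. ginv g \<kappa> x $ a $ b * hessian_diff g \<kappa> x \<tau> (\<lambda>_ _. 0) $ a $ b) = 0"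
      by (simp add: H laplacian_def cov_form_def)
  qed
qed

end

section \<open>Parallel tractors on conformal manifolds\<close>

locale parallel_tractor_field = conformal_structure X A \<C>
  for X :: "'a topology" and A :: "('a, 'n::finite) chart set" and \<C> +
  fixes \<I> :: "'a \<Rightarrow> ('a, 'n) tractor"
  assumes dim: "CARD('n) \<ge> 3"
    and parallel: "parallel_tractor X A \<C> \<I>"
begin

lemma tractor_at: "x \<in> topspace X \<Longrightarrow> \<I> x \<in> tractor_fibre X A \<C> x"
  using parallel by (auto simp: parallel_tractor_def tractor_field_def)

lemma parallel_chart:
  assumes g: "g \<in> \<C>" and \<kappa>: "\<kappa> \<in> A"
  shows "parallel_chart \<kappa> g (X_proj \<I> g) (\<lambda>a x. fst (snd (splitting g \<kappa> x (\<I> x))) $ a)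
    (\<lambda>x. snd (snd (splitting g \<kappa> x (\<I> x))))"
proof -
  interpret metric_chart \<kappa> g using metric_chart g \<kappa> .
  have sm: "smooth_in \<kappa> (fst \<kappa>) (\<lambda>x. fst (splitting g \<kappa> x (\<I> x)))"
     "\<And>a. smooth_in \<kappa> (fst \<kappa>) (\<lambda>x. fst (snd (splitting g \<kappa> x (\<I> x))) $ a)"
     "smooth_in \<kappa> (fst \<kappa>) (\<lambda>x. snd (snd (splitting g \<kappa> x (\<I> x))))"
    using parallel g \<kappa> unfolding parallel_tractor_def tractor_field_def by blast+
  have con: "tractor_connection g \<kappa> a (\<lambda>y. splitting g \<kappa> y (\<I> y)) x = (0, 0, 0)" if "x \<in> fst \<kappa>" for a x
    using parallel g \<kappa> that unfolding parallel_tractor_def by blast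
  have fst: "(\<lambda>x. fst (splitting g \<kappa> x (\<I> x))) = X_proj \<I> g"
    by (simp add: fst_splitting)
  show ?thesis
  proof
    show "CARD('n) \<ge> 3" by (rule dim)
  qed (use sm con in \<open>auto simp: tractor_connection_def Let_def fst fst_splitting vec_eq_iff\<close>)
qed

text \<open>The representative at \<open>x\<close> is chosen independently of any metric, so both
  sides evaluate one local density and its weight law applies.\<close>

lemma X_proj_rescale:
  assumes "g \<in> \<C>" "g' \<in> \<C>" "rescales A \<Omega> g g'" "x \<in> topspace X"
  shows "X_proj \<I> g' x = \<Omega> x powr 1 * X_proj \<I> g x"
proof -
  have "representative (\<I> x) \<in> loc x"
    using representative_tractor(1) tractor_at assms(4) by blast
  then obtain U where U: "x \<in> U" "density_on A \<C> 1 U (representative (\<I> x))"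
    unfolding local_densities_def by blast
  then show ?thesis unfolding X_proj_def density_on_def using assms by blast
qed

text \<open>Representatives at different points are unrelated choices; smoothness comes from the
  smooth components demanded of a tractor field.\<close>

lemma density_X_proj: "density_on A \<C> 1 (topspace X) (X_proj \<I>)"
proof -
  have "smooth_in \<kappa> (fst \<kappa>) (X_proj \<I> g)" if "g \<in> \<C>" "\<kappa> \<in> A" for g \<kappa>
    using parallel_chart.smooth_sigma[OF parallel_chart[OF that]] .
  then show ?thesis
    unfolding density_on_def smooth_fun_topspace using X_proj_rescale by blast
qed

lemma X_proj_zero_iff:
  assumes "g \<in> \<C>" "g' \<in> \<C>" "x \<in> topspace X"
  shows "X_proj \<I> g x = 0 \<longleftrightarrow> X_proj \<I> g' x = 0"
proof -
  obtain g0 where g0: "g0 \<in> \<C>" "\<And>g. g \<in> \<C> \<longleftrightarrow> is_metric A g \<and> (\<exists>\<Omega>. rescales A \<Omega> g0 g)"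
    using class_representative by blast
  obtain \<kappa> where \<kappa>: "\<kappa> \<in> A" "x \<in> fst \<kappa>" using chart_exists[OF assms(3)] by blast
  have base: "X_proj \<I> g x = 0 \<longleftrightarrow> X_proj \<I> g0 x = 0" if g: "g \<in> \<C>" for g
  proof -
    obtain \<Omega> where \<Omega>: "rescales A \<Omega> g0 g" using g0(2) g by blast
    then have "\<Omega> x > 0" using \<kappa> unfolding rescales_def by blast
    then show ?thesis using X_proj_rescale[OF g0(1) g \<Omega> assms(3)] by simp
  qed
  show ?thesis using base[OF assms(1)] base[OF assms(2)] by simp
qed

lemma scale_metric_einstein:
  assumes g: "g \<in> \<C>" and nz: "\<And>x. x \<in> topspace X \<Longrightarrow> X_proj \<I> g x \<noteq> 0"
  shows "scale_metric (X_proj \<I>) g \<in> \<C>" and "einstein A (scale_metric (X_proj \<I>) g)"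
proof -
  \<comment> \<open>The absolute value makes the factor positive as \<open>rescales\<close> demands,
    and its square is still that of \<open>inverse (X_proj \<I> g x)\<close>.\<close>
  let ?\<Omega> = "\<lambda>x. inverse \<bar>X_proj \<I> g x\<bar>" and ?g = "scale_metric (X_proj \<I>) g"
  have nz': "X_proj \<I> g x \<noteq> 0" if "\<kappa> \<in> A" "x \<in> fst \<kappa>" for \<kappa> x
    using nz chart_subset that by blast
  have res: "rescales A ?\<Omega> g ?g"
    unfolding rescales_def
  proof (intro ballI conjI)
    fix \<kappa> assume \<kappa>: "\<kappa> \<in> A"
    interpret parallel_chart \<kappa> g "X_proj \<I> g" "\<lambda>a x. fst (snd (splitting g \<kappa> x (\<I> x))) $ a"
      "\<lambda>x. snd (snd (splitting g \<kappa> x (\<I> x)))" using parallel_chart g \<kappa> .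
    show "smooth ?\<Omega>"
      using nz'[OF \<kappa>] by (intro smooth_inverse smooth_abs smooth_sigma) auto
  qed (use nz' in \<open>auto simp: scale_metric_def power_inverse\<close>)
  show g': "?g \<in> \<C>" by (rule rescaled_metric[OF g res])
  \<comment> \<open>By weight 1, \<sigma> in the new scale is \<sigma> divided by its absolute
    value.\<close>
  have unit: "X_proj \<I> ?g x * X_proj \<I> ?g x = 1" if "x \<in> topspace X" for x
    using nz[OF that] unfolding X_proj_rescale[OF g g' res that]
    by (auto simp: field_simps abs_if)
  show "einstein A ?g"
    unfolding einstein_def
  proof (intro conjI ballI allI)
    show "is_metric A ?g" by (rule metric_of_class[OF g'])
    fix \<kappa> x a b assume \<kappa>: "\<kappa> \<in> A" "x \<in> fst \<kappa>"
    show "schouten ?g \<kappa> x $ a $ b - 1 / real CARD('n) * trace_schouten ?g \<kappa> x * ?g \<kappa> x $ a $ b = 0"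
      using unit chart_subset[OF \<kappa>(1)]
      by (intro parallel_chart.unit_scale_einstein[OF parallel_chart[OF g' \<kappa>(1)] \<kappa>(2)]) blast
  qed
qed

section \<open>Zeros of the projection under weak genericity\<close>

context
  assumes generic: "weakly_generic A \<C>"
begin

text \<open>A zero seen in one scale \<open>g\<close> is transferred to every \<open>g'\<close>,
  because the relation defining tractors quantifies over all metrics of the class.\<close>

lemma splitting_zero:
  assumes "g \<in> \<C>" "x \<in> topspace X" "X_proj \<I> g x = 0" "g' \<in> \<C>" "\<kappa> \<in> A" "x \<in> fst \<kappa>"
  shows "splitting g' \<kappa> x (\<I> x) = 0"
proof -
  interpret parallel_chart \<kappa> g' "X_proj \<I> g'" "\<lambda>a x. fst (snd (splitting g' \<kappa> x (\<I> x))) $ a"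
    "\<lambda>x. snd (snd (splitting g' \<kappa> x (\<I> x)))" using parallel_chart assms(4,5) .
  have \<sigma>: "X_proj \<I> g' x = 0" using X_proj_zero_iff assms by blast
  have gen: "V = 0" if "\<forall>a b c. (\<Sum>d\<in>UNIV. weyl g' \<kappa> a b c d x * V $ d) = 0" for V
    using generic assms that unfolding weakly_generic_def by blast
  show ?thesis
    using zero_of_sigma[OF assms(6) \<sigma> gen] \<sigma>
    by (simp add: prod_eq_iff vec_eq_iff fst_splitting)
qed

lemma tractor_zero:
  assumes "g \<in> \<C>" "x \<in> topspace X" "X_proj \<I> g x = 0"
  shows "\<I> x = zero_tractor X A \<C> x"
proof -
  let ?\<tau> = "representative (\<I> x)"
  have "tractor_class X A \<C> x ?\<tau> = zero_tractor X A \<C> x"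
  proof (rule zero_tractorI[OF assms(2)])
    show "?\<tau> \<in> loc x" using representative_tractor(1) tractor_at assms(2) by blast
    fix g' \<kappa> assume "g' \<in> \<C>" "\<kappa> \<in> A" "x \<in> fst \<kappa>"
    from splitting_zero[OF assms this]
    show "?\<tau> g' x = 0 \<and> (\<forall>a. pd \<kappa> a (?\<tau> g') x = 0) \<and> laplacian g' \<kappa> (?\<tau> g') x = 0"
      by (auto simp: splitting_def Let_def prod_eq_iff vec_eq_iff)
  qed
  then show ?thesis using representative_tractor(2) tractor_at assms(2) by metis
qed

lemma X_proj_nonzero:
  assumes conn: "connected_space X" and nonzero: "\<exists>x\<in>topspace X. \<I> x \<noteq> zero_tractor X A \<C> x"
    and g: "g \<in> \<C>" and x: "x \<in> topspace X"
  shows "X_proj \<I> g x \<noteq> 0"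
proof
  assume zero: "X_proj \<I> g x = 0"
  let ?Z = "{y \<in> topspace X. X_proj \<I> g y = 0}" and ?N = "{y \<in> topspace X. X_proj \<I> g y \<noteq> 0}"
  have "openin X ?Z"
  proof (subst openin_subopen, intro ballI)
    fix y assume y: "y \<in> ?Z"
    then obtain \<kappa> where \<kappa>: "\<kappa> \<in> A" "y \<in> fst \<kappa>" using chart_exists by blast
    interpret parallel_chart \<kappa> g "X_proj \<I> g" "\<lambda>a x. fst (snd (splitting g \<kappa> x (\<I> x))) $ a"
      "\<lambda>x. snd (snd (splitting g \<kappa> x (\<I> x)))" using parallel_chart g \<kappa>(1) .
    have y0: "y \<in> topspace X" "X_proj \<I> g y = 0" using y by blast+
    \<comment> \<open>The zero of \<sigma> alone would not propagate; \<open>splitting_zero\<close>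
      supplies those of \<mu> and \<rho>.\<close>
    obtain V where V: "open V" "snd \<kappa> y \<in> V" "\<forall>z\<in>fst \<kappa>. snd \<kappa> z \<in> V \<longrightarrow> X_proj \<I> g z = 0"
      using zero_near[OF \<kappa>(2) y0(2)] splitting_zero[OF g y0 g \<kappa>] by auto
    show "\<exists>T. openin X T \<and> y \<in> T \<and> T \<subseteq> ?Z"
      using openin_preimage[OF \<kappa>(1) V(1)] \<kappa> V chart_subset[OF \<kappa>(1)]
      by (intro exI[of _ "{z \<in> fst \<kappa>. snd \<kappa> z \<in> V}"]) auto
  qed
  moreover have "openin X ?N"
  proof (subst openin_subopen, intro ballI)
    fix y assume y: "y \<in> ?N"
    then obtain \<kappa> where \<kappa>: "\<kappa> \<in> A" "y \<in> fst \<kappa>" using chart_exists by blast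
    interpret parallel_chart \<kappa> g "X_proj \<I> g" "\<lambda>a x. fst (snd (splitting g \<kappa> x (\<I> x))) $ a"
      "\<lambda>x. snd (snd (splitting g \<kappa> x (\<I> x)))" using parallel_chart g \<kappa>(1) .
    \<comment> \<open>The coordinate representation is controlled only on the chart image, hence the
      intersection.\<close>
    let ?V = "coord_rep \<kappa> (X_proj \<I> g) -` (- {0}) \<inter> snd \<kappa> ` fst \<kappa>"
    have "open ?V"
      using smooth_continuous[OF smooth_sigma] continuous_on_open_vimage[OF op] by blast
    then have "openin X {z \<in> fst \<kappa>. snd \<kappa> z \<in> ?V}"
      by (rule openin_preimage[OF \<kappa>(1)])
    also have "{z \<in> fst \<kappa>. snd \<kappa> z \<in> ?V} = {z \<in> fst \<kappa>. X_proj \<I> g z \<noteq> 0}"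
      by (intro Collect_cong conj_cong refl) (simp add: coord_rep_at imageI)
    finally show "\<exists>T. openin X T \<and> y \<in> T \<and> T \<subseteq> ?N"
      using y \<kappa>(2) chart_subset[OF \<kappa>(1)] by blast
  qed
  \<comment> \<open>If \<sigma> vanished everywhere, so would the tractor field by
    \<open>tractor_zero\<close>.\<close>
  moreover have "?N \<noteq> {}" using nonzero tractor_zero[OF g] by blast
  ultimately show False
    using conn x zero unfolding connected_space_def by blast
qed

end

end

theorem theorem3p4:
  fixes X :: "'a topology"
    and A :: "('a, 'n::finite) chart set"
    and \<C> :: "('a, 'n) metric set"
    and \<I> :: "'a \<Rightarrow> ('a, 'n) tractor"
  assumes dim: "CARD('n) \<ge> 3"
    and conf: "conformal_manifold X A \<C>"
    and conn: "connected_space X"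
    and generic: "weakly_generic A \<C>"
    and parallel: "parallel_tractor X A \<C> \<I>"
    and nonzero: "\<exists>x\<in>topspace X. \<I> x \<noteq> zero_tractor X A \<C> x"
  shows "conformally_einstein A \<C> \<and> einstein_scale X A \<C> (X_proj \<I>)"
proof -
  interpret parallel_tractor_field X A \<C> \<I>
    by unfold_locales (fact conf dim parallel)+
  have nz: "X_proj \<I> g x \<noteq> 0" if "g \<in> \<C>" "x \<in> topspace X" for g x
    using X_proj_nonzero[OF generic conn nonzero that] .
  obtain g0 where "g0 \<in> \<C>" using class_representative by blast
  then have "conformally_einstein A \<C>"
    using scale_metric_einstein nz unfolding conformally_einstein_def by blast
  moreover have "einstein_scale X A \<C> (X_proj \<I>)"
    using density_X_proj scale_metric_einstein nz unfolding einstein_scale_def by blast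
  ultimately show ?thesis ..
qed

end
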